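(* Let $U^n=\big((\mathbf f_{j_1,j_2}^n)_{j_1,j_2},\mathbf B^n,\mathbf E_2^n,\mathbf E_1^n\big)$, $n\in\mathbb N$, be produced by the exponential (Lawson) DG scheme $$U^{n+1}=\exp(\Delta t\,L)U^n+\Delta t\,\exp(\Delta t\,L)N(U^n)$$ for the semi-discretized 1dx-2dv Vlasov-Maxwell system (with $L$, $N$ and the expression of $\exp(tL)$ as given in the context), or by its generalization to high order Lawson Runge-Kutta methods (see context). Then the scheme preserves the discrete Poisson equation $$(A+\Pi)\,\mathbf E_1^n=-\sum_{j_1,j_2}(\mathbf 1-\Pi)\,\mathbf f^n_{j_1,j_2}\,\Delta v_1\Delta v_2,\qquad \forall n\in\mathbb N,\ n\ge1,$$ provided that it is satisfied at the initial time $n=0$. Here $A$ is the DG matrix, $\Pi$ is the orthogonal projection onto $\mathrm{Ker}(A)$ and $\mathbf 1$ is the identity matrix of size $\tilde N=(k+1)N_x$.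
   Context: DG matrix. Let $k\ge 0$, $N_x\ge1$ be integers, $L_0>0$, $\Delta x=L_0/N_x$; the periodic interval $[0,L_0]$ is divided into $N_x$ cells $I_i$ of length $\Delta x$ with centers $x_i$, and on $I_i$ one uses the basis $\xi_i^m(x)=((x-x_i)/\Delta x)^m$, $m=0,\dots,k$. Put $\tilde N=(k+1)N_x$. A vector $\mathbf u\in\mathbb R^{\tilde N}$ is written as $\mathbf u=(\mathbf u_1,\dots,\mathbf u_{N_x})$, $\mathbf u_i=(u_i^0,\dots,u_i^k)$, and represents the piecewise polynomial $u_h|_{I_i}=\sum_m u_i^m\xi_i^m$. Define $(k+1)\times(k+1)$ matrices, for $\ell,m=1,\dots,k+1$, by $M_{\ell,m}=\frac{(1/2)^{m+\ell-1}}{m+\ell-1}[1-(-1)^{m+\ell-1}]$, $(D_1)_{\ell,m}=(1/2)^{m+\ell-2}\big(\frac{\ell-1}{m+\ell-2}-\frac12\big)[1-(-1)^{m+\ell-2}]$ with $(D_1)_{1,1}=0$, $(D_2)_{\ell,m}=(-1)^m(1/2)^{m+\ell-1}$, $(D_3)_{\ell,m}=(-1)^{\ell-1}(1/2)^{m+\ell-1}$. The DG matrix $A\in\mathbb R^{\tilde N\times\tilde N}$ is the block circulant matrix acting by $(A\mathbf u)_i=\frac1{\Delta x}M^{-1}(D_1\mathbf u_i+D_2\mathbf u_{i+1}+D_3\mathbf u_{i-1})$, cell indices modulo $N_x$. $\Pi$ is the orthogonal projection onto $\mathrm{Ker}(A)$. Semi-discretization. For $\ell=1,2$, $v_{\ell,\max}>0$,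 $\Delta v_\ell=2v_{\ell,\max}/N_{v_\ell}$, $v_{\ell,j}=-v_{\ell,\max}+j\Delta v_\ell$, $j=1,\dots,N_{v_\ell}$. Unknowns: $\mathbf f_{j_1,j_2},\mathbf B,\mathbf E_1,\mathbf E_2\in\mathbb R^{\tilde N}$. For $\mathbf G\in\mathbb R^{\tilde N}$ representing $G_h$, $\tilde{\mathbf G}$ is the $\tilde N\times\tilde N$ block diagonal matrix with blocks $(\Delta xM)^{-1}B_i$, $(B_i)_{\ell,m}=\int_{I_i}G_h\,\xi_i^m\xi_i^\ell\,dx$, $\ell,m=0,\dots,k$. The nonlinear term is $(\tilde{\mathcal F}\mathcal D\mathbf f)_{j_1,j_2}=(\tilde{\mathbf E}_1+v_{2,j_2}\tilde{\mathbf B})(\mathcal D_1\mathbf f)_{j_1,j_2}+(\tilde{\mathbf E}_2-v_{1,j_1}\tilde{\mathbf B})(\mathcal D_2\mathbf f)_{j_1,j_2}$, where $\mathcal D_1$, $\mathcal D_2$ are linear finite difference operators in the indices $j_1$, $j_2$ respectively (acting on each DG coefficient) approximating $\partial_{v_1},\partial_{v_2}$, conservative in the sense that $\sum_{j_1}(\mathcal D_1\mathbf f)_{j_1,j_2}=0$ for each $j_2$ and $\sum_{j_2}(\mathcal D_2\mathbf f)_{j_1,j_2}=0$ for each $j_1$. The semi-discrete system is $$\partial_t\mathbf f_{j_1,j_2}=v_{1,j_1}A\mathbf f_{j_1,j_2}-(\tilde{\mathcal F}\mathcal D\mathbf f)_{j_1,j_2},\quad \partial_t\mathbf B=A\mathbf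 E_2,$$ $$\partial_t\mathbf E_1=-\sum_{j_1,j_2}v_{1,j_1}(\mathbf 1-\Pi)\mathbf f_{j_1,j_2}\Delta v_1\Delta v_2,\quad \partial_t\mathbf E_2=A\mathbf B-\sum_{j_1,j_2}v_{2,j_2}(\mathbf 1-\Pi)\mathbf f_{j_1,j_2}\Delta v_1\Delta v_2,$$ written as $\partial_tU=LU+N(U)$, $U=((\mathbf f_{j_1,j_2}),\mathbf B,\mathbf E_2,\mathbf E_1)$, where $N(U)$ has $\mathbf f_{j_1,j_2}$-component $-(\tilde{\mathcal F}\mathcal D\mathbf f)_{j_1,j_2}$ and zero field components, and $L$ collects all other (linear) terms. $\Delta t>0$ is the time step. Exponential. The scheme uses the expression $\exp(tL)U=\big((\hat{\mathbf f}_{j_1,j_2}),\hat{\mathbf B},\hat{\mathbf E}_2,\hat{\mathbf E}_1\big)$ with $\hat{\mathbf f}_{j_1,j_2}=e^{v_{1,j_1}At}\mathbf f_{j_1,j_2}$, $\hat{\mathbf B}=\frac{e^{At}+e^{-At}}2\mathbf B+\frac{e^{At}-e^{-At}}2\mathbf E_2+\Delta v_1\Delta v_2(A+\Pi)^{-1}\sum_{j_1,j_2}v_{2,j_2}\alpha_{j_1}\mathbf f_{j_1,j_2}$, $\hat{\mathbf E}_2=\frac{e^{At}-e^{-At}}2\mathbf B+\frac{e^{At}+e^{-At}}2\mathbf E_2+\Delta v_1\Delta v_2(A+\Pi)^{-1}\sum_{j_1,j_2}v_{2,j_2}\beta_{j_1}\mathbf f_{j_1,j_2}$, $\hat{\mathbf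 E}_1=\mathbf E_1+\Delta v_1\Delta v_2(A+\Pi)^{-1}\sum_{j_1,j_2}(\mathbf 1-e^{v_{1,j_1}At})\mathbf f_{j_1,j_2}$, where $\alpha_{j_1}=\frac{-e^{At}}{2(1-v_{1,j_1})}-\frac{e^{-At}}{2(1+v_{1,j_1})}+\frac{e^{v_{1,j_1}At}}{1-v_{1,j_1}^2}$ and $\beta_{j_1}=\frac{-e^{At}}{2(1-v_{1,j_1})}+\frac{e^{-At}}{2(1+v_{1,j_1})}+\frac{v_{1,j_1}e^{v_{1,j_1}At}}{1-v_{1,j_1}^2}$. Lawson Runge-Kutta schemes. For an explicit Runge-Kutta method with $s$ stages and Butcher coefficients $(a_{pq})_{q<p},(b_p),(c_p)$: $U^{(p)}=e^{c_p\Delta tL}U^n+\Delta t\sum_{q<p}a_{pq}e^{(c_p-c_q)\Delta tL}N(U^{(q)})$ for $p=1,\dots,s$, and $U^{n+1}=e^{\Delta tL}U^n+\Delta t\sum_{p=1}^sb_pe^{(1-c_p)\Delta tL}N(U^{(p)})$.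
   Formalization: The orthogonal projection Π onto Ker(A) is taken orthogonal in L²(0,L₀) of the represented piecewise polynomials, not in the dot product of coefficient vectors; the two agree for k ≤ 1, and for k ≥ 2 the claim fails with the dot product. *)

theory Defs
  imports
    "HOL-Analysis.Henstock_Kurzweil_Integration"
    "Jordan_Normal_Form.Gauss_Jordan_Elimination"
    "Jordan_Normal_Form.Matrix_Kernel"
begin

section \<open>Matrix preliminaries\<close>

text \<open>Only meaningful for invertible matrices; the library returns \<open>None\<close> otherwise.\<close>

definition minv :: "real mat \<Rightarrow> real mat" where
  "minv X = the (mat_inverse X)"

definition matexp :: "real mat \<Rightarrow> real mat" where
  "matexp X = mat (dim_row X) (dim_row X)
     (\<lambda>(r, c). \<Sum>p. (X ^\<^sub>m p) $$ (r, c) / fact p)"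

section \<open>The discretization\<close>

text \<open>
  \<open>pdeg\<close> is the polynomial degree, \<open>ncell\<close> the number of cells and \<open>xlen\<close> the length of the
  periodic interval; \<open>vmax1\<close>, \<open>nv1\<close> and \<open>vmax2\<close>, \<open>nv2\<close> determine the two velocity grids.
  The finite difference operators in the first and second velocity index are given by their
  coefficients \<open>fd1\<close> and \<open>fd2\<close> (output index first); boundary conditions in velocity are part of
  these coefficients.
\<close>

record vm_disc =
  pdeg :: nat
  ncell :: nat
  xlen :: real
  vmax1 :: real
  vmax2 :: real
  nv1 :: nat
  nv2 :: nat
  fd1 :: "nat \<Rightarrow> nat \<Rightarrow> real"
  fd2 :: "nat \<Rightarrow> nat \<Rightarrow> real"

definition dx :: "vm_disc \<Rightarrow> real" where
  "dx G = xlen G / real (ncell G)"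

definition ndof :: "vm_disc \<Rightarrow> nat" where
  "ndof G = (pdeg G + 1) * ncell G"

definition dv1 :: "vm_disc \<Rightarrow> real" where
  "dv1 G = 2 * vmax1 G / real (nv1 G)"

definition dv2 :: "vm_disc \<Rightarrow> real" where
  "dv2 G = 2 * vmax2 G / real (nv2 G)"

definition v1 :: "vm_disc \<Rightarrow> nat \<Rightarrow> real" where
  "v1 G j = - vmax1 G + real j * dv1 G"

definition v2 :: "vm_disc \<Rightarrow> nat \<Rightarrow> real" where
  "v2 G j = - vmax2 G + real j * dv2 G"

section \<open>The DG matrix\<close>

text \<open>
  Matrix entries are indexed from 0 in the library; the entry formulas below are written in the
  1-based indices \<open>l\<close>, \<open>m\<close>.
\<close>

definition mass_mat :: "nat \<Rightarrow> real mat" where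
  "mass_mat k = mat (k + 1) (k + 1) (\<lambda>(i, j). let l = i + 1; m = j + 1 in
     (1/2) ^ (m + l - 1) / real (m + l - 1) * (1 - (-1) ^ (m + l - 1)))"

definition D1_mat :: "nat \<Rightarrow> real mat" where
  "D1_mat k = mat (k + 1) (k + 1) (\<lambda>(i, j). let l = i + 1; m = j + 1 in
     if l = 1 \<and> m = 1 then 0
     else (1/2) ^ (m + l - 2) * (real (l - 1) / real (m + l - 2) - 1/2)
            * (1 - (-1) ^ (m + l - 2)))"

definition D2_mat :: "nat \<Rightarrow> real mat" where
  "D2_mat k = mat (k + 1) (k + 1) (\<lambda>(i, j). let l = i + 1; m = j + 1 in
     (-1) ^ m * (1/2) ^ (m + l - 1))"

definition D3_mat :: "nat \<Rightarrow> real mat" where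
  "D3_mat k = mat (k + 1) (k + 1) (\<lambda>(i, j). let l = i + 1; m = j + 1 in
     (-1) ^ (l - 1) * (1/2) ^ (m + l - 1))"

text \<open>
  Cells are numbered from 0, and the coefficient of \<open>\<xi>\<^sub>i\<^sup>m\<close> sits at position \<open>i (k + 1) + m\<close>.
  The three blocks are added up, since they overlap when there are fewer than three cells.
\<close>

definition dg_mat :: "vm_disc \<Rightarrow> real mat" where
  "dg_mat G = (1 / dx G) \<cdot>\<^sub>m mat (ndof G) (ndof G) (\<lambda>(r, c).
     let K = pdeg G + 1; Mi = minv (mass_mat (pdeg G));
         i = r div K; l = r mod K; i' = c div K; m = c mod K
     in (if i' = i then (Mi * D1_mat (pdeg G)) $$ (l, m) else 0)
      + (if i' = (i + 1) mod ncell G then (Mi * D2_mat (pdeg G)) $$ (l, m) else 0)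
      + (if i = (i' + 1) mod ncell G then (Mi * D3_mat (pdeg G)) $$ (l, m) else 0))"

section \<open>Piecewise polynomials and the projection onto the kernel\<close>

definition cell_coeffs :: "vm_disc \<Rightarrow> real vec \<Rightarrow> nat \<Rightarrow> real vec" where
  "cell_coeffs G u i = vec (pdeg G + 1) (\<lambda>m. u $ (i * (pdeg G + 1) + m))"

definition cell :: "vm_disc \<Rightarrow> nat \<Rightarrow> real set" where
  "cell G i = {real i * dx G .. real (i + 1) * dx G}"

definition xi :: "vm_disc \<Rightarrow> nat \<Rightarrow> nat \<Rightarrow> real \<Rightarrow> real" where
  "xi G i m x = ((x - (real i + 1/2) * dx G) / dx G) ^ m"

text \<open>The restriction to the \<open>i\<close>-th cell of the function represented by \<open>u\<close>.\<close>

definition cell_fun :: "vm_disc \<Rightarrow> real vec \<Rightarrow> nat \<Rightarrow> real \<Rightarrow> real" where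
  "cell_fun G u i x = (\<Sum>m\<le>pdeg G. cell_coeffs G u i $ m * xi G i m x)"

definition dg_inner :: "vm_disc \<Rightarrow> real vec \<Rightarrow> real vec \<Rightarrow> real" where
  "dg_inner G u w =
     (\<Sum>i<ncell G. integral (cell G i) (\<lambda>x. cell_fun G u i x * cell_fun G w i x))"

text \<open>
  Orthogonality is that of the represented functions in \<open>L\<^sup>2(0, L\<^sub>0)\<close>. The dot product of the
  coefficient vectors would define the same projection for degree at most 1. For degree 2 and
  above it would not: the identity \<open>\<Pi> A = 0\<close>, on which the closed form of the exponential
  below relies, would fail, because the DG matrix is skew-adjoint for the \<open>L\<^sup>2\<close> product only.
\<close>

definition kernel_projection :: "vm_disc \<Rightarrow> real mat \<Rightarrow> bool" where
  "kernel_projection G P \<longleftrightarrow>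
     P \<in> carrier_mat (ndof G) (ndof G) \<and>
     (\<forall>u \<in> carrier_vec (ndof G).
        P *\<^sub>v u \<in> mat_kernel (dg_mat G) \<and>
        (\<forall>w \<in> mat_kernel (dg_mat G). dg_inner G (u - P *\<^sub>v u) w = 0))"

section \<open>States\<close>

text \<open>
  The distribution function takes the velocity indices \<open>1 \<le> j1 \<le> nv1\<close> and
  \<open>1 \<le> j2 \<le> nv2\<close>; its values at other indices are never used.
\<close>

record vm_state =
  sf :: "nat \<Rightarrow> nat \<Rightarrow> real vec"
  sB :: "real vec"
  sE2 :: "real vec"
  sE1 :: "real vec"

definition vm_state_wf :: "vm_disc \<Rightarrow> vm_state \<Rightarrow> bool" where
  "vm_state_wf G U \<longleftrightarrow>
     (\<forall>j1 \<in> {1..nv1 G}. \<forall>j2 \<in> {1..nv2 G}. sf U j1 j2 \<in> carrier_vec (ndof G)) \<and>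
     sB U \<in> carrier_vec (ndof G) \<and> sE2 U \<in> carrier_vec (ndof G) \<and> sE1 U \<in> carrier_vec (ndof G)"

definition vel_sum :: "vm_disc \<Rightarrow> (nat \<Rightarrow> nat \<Rightarrow> real vec) \<Rightarrow> real vec" where
  "vel_sum G F = vec (ndof G) (\<lambda>r. \<Sum>j1 = 1..nv1 G. \<Sum>j2 = 1..nv2 G. F j1 j2 $ r)"

text \<open>The state \<open>U + h (\<Sum>q\<in>Q. w q \<cdot> V q)\<close>.\<close>

definition add_incr ::
  "vm_disc \<Rightarrow> vm_state \<Rightarrow> real \<Rightarrow> nat set \<Rightarrow> (nat \<Rightarrow> real) \<Rightarrow> (nat \<Rightarrow> vm_state) \<Rightarrow> vm_state" where
  "add_incr G U h Q w V =
     (let comb = (\<lambda>u z. vec (ndof G) (\<lambda>r. u $ r + h * (\<Sum>q\<in>Q. w q * z q $ r)))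
      in \<lparr> sf = (\<lambda>j1 j2. comb (sf U j1 j2) (\<lambda>q. sf (V q) j1 j2)),
           sB = comb (sB U) (\<lambda>q. sB (V q)),
           sE2 = comb (sE2 U) (\<lambda>q. sE2 (V q)),
           sE1 = comb (sE1 U) (\<lambda>q. sE1 (V q)) \<rparr>)"

section \<open>The nonlinear term\<close>

definition mult_mat :: "vm_disc \<Rightarrow> real vec \<Rightarrow> real mat" where
  "mult_mat G g = diag_block_mat (map (\<lambda>i.
     minv (dx G \<cdot>\<^sub>m mass_mat (pdeg G)) *
     mat (pdeg G + 1) (pdeg G + 1)
       (\<lambda>(l, m). integral (cell G i) (\<lambda>x. cell_fun G g i x * xi G i m x * xi G i l x)))
     [0..<ncell G])"

definition FD1 :: "vm_disc \<Rightarrow> (nat \<Rightarrow> nat \<Rightarrow> real vec) \<Rightarrow> nat \<Rightarrow> nat \<Rightarrow> real vec" where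
  "FD1 G f j1 j2 = vec (ndof G) (\<lambda>r. \<Sum>j = 1..nv1 G. fd1 G j1 j * f j j2 $ r)"

definition FD2 :: "vm_disc \<Rightarrow> (nat \<Rightarrow> nat \<Rightarrow> real vec) \<Rightarrow> nat \<Rightarrow> nat \<Rightarrow> real vec" where
  "FD2 G f j1 j2 = vec (ndof G) (\<lambda>r. \<Sum>j = 1..nv2 G. fd2 G j2 j * f j1 j $ r)"

definition fd_conservative :: "vm_disc \<Rightarrow> bool" where
  "fd_conservative G \<longleftrightarrow>
     (\<forall>f. (\<forall>j1 \<in> {1..nv1 G}. \<forall>j2 \<in> {1..nv2 G}. f j1 j2 \<in> carrier_vec (ndof G)) \<longrightarrow>
        (\<forall>j2 \<in> {1..nv2 G}. \<forall>r < ndof G. (\<Sum>j1 = 1..nv1 G. FD1 G f j1 j2 $ r) = 0) \<and>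
        (\<forall>j1 \<in> {1..nv1 G}. \<forall>r < ndof G. (\<Sum>j2 = 1..nv2 G. FD2 G f j1 j2 $ r) = 0))"

definition vm_N :: "vm_disc \<Rightarrow> vm_state \<Rightarrow> vm_state" where
  "vm_N G U =
     \<lparr> sf = (\<lambda>j1 j2. -
         ((mult_mat G (sE1 U) + v2 G j2 \<cdot>\<^sub>m mult_mat G (sB U)) *\<^sub>v FD1 G (sf U) j1 j2
        + (mult_mat G (sE2 U) - v1 G j1 \<cdot>\<^sub>m mult_mat G (sB U)) *\<^sub>v FD2 G (sf U) j1 j2)),
       sB = 0\<^sub>v (ndof G), sE2 = 0\<^sub>v (ndof G), sE1 = 0\<^sub>v (ndof G) \<rparr>"

section \<open>The exponential of the linear part\<close>

definition expA :: "vm_disc \<Rightarrow> real \<Rightarrow> real mat" where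
  "expA G t = matexp (t \<cdot>\<^sub>m dg_mat G)"

definition vm_alpha :: "vm_disc \<Rightarrow> real \<Rightarrow> nat \<Rightarrow> real mat" where
  "vm_alpha G t j =
     (- 1 / (2 * (1 - v1 G j))) \<cdot>\<^sub>m expA G t
   - (1 / (2 * (1 + v1 G j))) \<cdot>\<^sub>m expA G (- t)
   + (1 / (1 - (v1 G j)\<^sup>2)) \<cdot>\<^sub>m expA G (v1 G j * t)"

definition vm_beta :: "vm_disc \<Rightarrow> real \<Rightarrow> nat \<Rightarrow> real mat" where
  "vm_beta G t j =
     (- 1 / (2 * (1 - v1 G j))) \<cdot>\<^sub>m expA G t
   + (1 / (2 * (1 + v1 G j))) \<cdot>\<^sub>m expA G (- t)
   + (v1 G j / (1 - (v1 G j)\<^sup>2)) \<cdot>\<^sub>m expA G (v1 G j * t)"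

text \<open>
  The closed form of \<open>exp (t L) U\<close>, where \<open>L\<close> is the linear part of the semi-discrete system
  \<open>\<partial>\<^sub>t f = v\<^sub>1 A f\<close>, \<open>\<partial>\<^sub>t B = A E\<^sub>2\<close>,
  \<open>\<partial>\<^sub>t E\<^sub>1 = - \<Sum> v\<^sub>1 (1 - \<Pi>) f \<Delta>v\<^sub>1 \<Delta>v\<^sub>2\<close>,
  \<open>\<partial>\<^sub>t E\<^sub>2 = A B - \<Sum> v\<^sub>2 (1 - \<Pi>) f \<Delta>v\<^sub>1 \<Delta>v\<^sub>2\<close>, and \<open>P\<close> is the projection \<open>\<Pi>\<close>.
  If some \<open>v\<^sub>1\<close> equals 1 or -1, the fractions in \<open>vm_alpha\<close> and \<open>vm_beta\<close> have a zero
  denominator and the components \<open>sB\<close>, \<open>sE2\<close> carry no meaning; \<open>sf\<close> and \<open>sE1\<close> do not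
  involve these fractions.
\<close>

definition vm_exp :: "vm_disc \<Rightarrow> real mat \<Rightarrow> real \<Rightarrow> vm_state \<Rightarrow> vm_state" where
  "vm_exp G P t U =
     (let R = minv (dg_mat G + P);
          ch = (1/2) \<cdot>\<^sub>m (expA G t + expA G (- t));
          sh = (1/2) \<cdot>\<^sub>m (expA G t - expA G (- t))
      in \<lparr> sf = (\<lambda>j1 j2. expA G (v1 G j1 * t) *\<^sub>v sf U j1 j2),
           sB = ch *\<^sub>v sB U + sh *\<^sub>v sE2 U + (dv1 G * dv2 G) \<cdot>\<^sub>v (R *\<^sub>v
                vel_sum G (\<lambda>j1 j2. v2 G j2 \<cdot>\<^sub>v (vm_alpha G t j1 *\<^sub>v sf U j1 j2))),
           sE2 = sh *\<^sub>v sB U + ch *\<^sub>v sE2 U + (dv1 G * dv2 G) \<cdot>\<^sub>v (R *\<^sub>v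
                vel_sum G (\<lambda>j1 j2. v2 G j2 \<cdot>\<^sub>v (vm_beta G t j1 *\<^sub>v sf U j1 j2))),
           sE1 = sE1 U + (dv1 G * dv2 G) \<cdot>\<^sub>v (R *\<^sub>v
                vel_sum G (\<lambda>j1 j2. (1\<^sub>m (ndof G) - expA G (v1 G j1 * t)) *\<^sub>v sf U j1 j2)) \<rparr>)"

section \<open>The schemes\<close>

definition lawson_euler :: "vm_disc \<Rightarrow> real mat \<Rightarrow> real \<Rightarrow> vm_state \<Rightarrow> vm_state" where
  "lawson_euler G P h U =
     add_incr G (vm_exp G P h U) h {0} (\<lambda>_. 1) (\<lambda>_. vm_exp G P h (vm_N G U))"

text \<open>
  One step of the Lawson method of an explicit Runge-Kutta method with \<open>s\<close> stages: \<open>S p\<close> is the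
  \<open>p\<close>-th stage. The stage equations determine the stages recursively.
\<close>

definition lawson_rk_step ::
  "vm_disc \<Rightarrow> real mat \<Rightarrow> real \<Rightarrow> nat \<Rightarrow> (nat \<Rightarrow> nat \<Rightarrow> real) \<Rightarrow> (nat \<Rightarrow> real) \<Rightarrow> (nat \<Rightarrow> real)
     \<Rightarrow> vm_state \<Rightarrow> vm_state \<Rightarrow> bool" where
  "lawson_rk_step G P h s a b c U U' \<longleftrightarrow>
     (\<exists>S. (\<forall>p \<in> {1..s}. S p =
             add_incr G (vm_exp G P (c p * h) U) h {1..<p} (a p)
               (\<lambda>q. vm_exp G P ((c p - c q) * h) (vm_N G (S q)))) \<and>
          U' = add_incr G (vm_exp G P h U) h {1..s} b
                 (\<lambda>p. vm_exp G P ((1 - c p) * h) (vm_N G (S p))))"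

section \<open>The discrete Poisson equation\<close>

definition discrete_poisson :: "vm_disc \<Rightarrow> real mat \<Rightarrow> vm_state \<Rightarrow> bool" where
  "discrete_poisson G P U \<longleftrightarrow>
     (dg_mat G + P) *\<^sub>v sE1 U =
       - vel_sum G (\<lambda>j1 j2. (dv1 G * dv2 G) \<cdot>\<^sub>v ((1\<^sub>m (ndof G) - P) *\<^sub>v sf U j1 j2))"

end

theory Submission
  imports Defs "HOL-Analysis.Equivalence_Lebesgue_Henstock_Integration"
begin

text \<open>
  The DG matrix \<open>A\<close> is skew-adjoint for the \<open>L\<^sup>2\<close> product of piecewise polynomials, so its range is
  orthogonal to its kernel and \<open>\<Pi> A = 0\<close>. Hence \<open>A + \<Pi>\<close> is injective and \<open>\<Pi> exp (t A) = \<Pi>\<close>.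
  Let \<open>\<rho>\<close> denote the sum of \<open>f\<close> over the velocities. The \<open>E\<^sub>1\<close> component of the exponential adds
  \<open>\<Delta>v\<^sub>1 \<Delta>v\<^sub>2 (A + \<Pi>)\<inverse>\<close> times the decrease of \<open>\<rho>\<close>, and \<open>\<rho>\<close> vanishes on the nonlinear term because the
  differences are conservative. So over one step \<open>(A + \<Pi>) E\<^sub>1\<close> changes by \<open>- \<Delta>v\<^sub>1 \<Delta>v\<^sub>2\<close> times the change
  of \<open>\<rho>\<close>, while \<open>\<Pi> \<rho>\<close> stays constant.
\<close>

unbundle no vec_syntax

section \<open>The mass matrix\<close>

lemma mass_mat_dim [simp]: "dim_row (mass_mat k) = Suc k" "dim_col (mass_mat k) = Suc k"
  by (simp_all add: mass_mat_def)

lemma mass_mat_carrier: "mass_mat k \<in> carrier_mat (k + 1) (k + 1)"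
  by auto

lemma mass_mat_index:
  assumes "i \<le> k" "j \<le> k"
  shows "mass_mat k $$ (i, j) = (1/2) ^ (i + j + 1) / real (i + j + 1) * (1 - (-1) ^ (i + j + 1))"
proof -
  have "j + 1 + (i + 1) - 1 = i + j + 1" by simp
  then show ?thesis using assms by (simp only: mass_mat_def Let_def) (simp add: add.commute)
qed

lemma has_real_derivative_scaled_power:
  fixes d z :: real
  shows "((\<lambda>x. ((x - z) / d) ^ (p + 1)) has_real_derivative
    real (p + 1) * ((x - z) / d) ^ p * (1 / d)) (at x within S)"
proof -
  have "((\<lambda>x. (x - z) / d) has_real_derivative (1 - 0) / d) (at x within S)"
    by (intro DERIV_cdivide DERIV_diff DERIV_ident DERIV_const)
  from DERIV_power[OF this, of "p + 1"] show ?thesis by (simp add: mult_ac)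
qed

text \<open>With \<open>y = (x - z) / d\<close>, an antiderivative is
  \<open>d * y ^ (p + 1) / real (p + 1)\<close>, and the ends of the cell are
  \<open>y = -1/2\<close> and \<open>y = 1/2\<close>. The result is \<open>d\<close> times the
  closed formula for the mass matrix entries with \<open>i + j = p\<close>.\<close>

lemma has_integral_scaled_monomial:
  fixes d z :: real
  assumes "d > 0"
  shows "((\<lambda>x. ((x - z) / d) ^ p) has_integral
           d * ((1/2) ^ (p + 1) / real (p + 1) * (1 - (-1) ^ (p + 1)))) {z - d/2..z + d/2}"
proof -
  let ?F = "\<lambda>x. d * ((x - z) / d) ^ (p + 1) / real (p + 1)"
  have "((\<lambda>x. ((x - z) / d) ^ p) has_integral ?F (z + d/2) - ?F (z - d/2)) {z - d/2..z + d/2}"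
  proof (rule fundamental_theorem_of_calculus)
    show "z - d/2 \<le> z + d/2" using assms by simp
    fix x
    have "(?F has_real_derivative
        d * (real (p + 1) * ((x - z) / d) ^ p * (1 / d)) / real (p + 1)) (at x within {z - d/2..z + d/2})"
      by (rule DERIV_cdivide, rule DERIV_cmult, rule has_real_derivative_scaled_power)
    also have "d * (real (p + 1) * ((x - z) / d) ^ p * (1 / d)) / real (p + 1) = ((x - z) / d) ^ p"
      using assms by (simp del: of_nat_add of_nat_Suc)
    finally show "(?F has_vector_derivative ((x - z) / d) ^ p) (at x within {z - d/2..z + d/2})"
      by (simp add: has_real_derivative_iff_has_vector_derivative)
  qed
  moreover have "?F (z + d/2) - ?F (z - d/2) =
      d * ((1/2) ^ (p + 1) / real (p + 1) * (1 - (-1) ^ (p + 1)))"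
  proof -
    \<comment> \<open>Writing -1/2 as a product splits off the power of -1 that appears in the mass
      matrix.\<close>
    have bounds: "(z + d/2 - z) / d = 1/2" "(z - d/2 - z) / d = (-1) * (1/2)"
      using assms by (auto simp: field_simps)
    have "d * X / q - d * (Y * X) / q = d * (X / q * (1 - Y))" for X Y q :: real
      by (simp add: algebra_simps diff_divide_distrib)
    then show ?thesis by (simp only: bounds power_mult_distrib)
  qed
  ultimately show ?thesis by simp
qed

text \<open>Products of scaled monomials are scaled monomials, so \<open>d\<close> times the mass
  matrix is the Gram matrix of the monomial basis on a cell of length \<open>d\<close>.\<close>

lemma integral_prod_scaled_poly:
  fixes d z :: real
  assumes "d > 0"
  shows "integral {z - d/2..z + d/2}
      (\<lambda>x. (\<Sum>m\<le>k. a m * ((x - z) / d) ^ m) * (\<Sum>l\<le>k. b l * ((x - z) / d) ^ l))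
    = (\<Sum>m\<le>k. \<Sum>l\<le>k. a m * b l * (d * mass_mat k $$ (m, l)))"
proof (rule integral_unique)
  have eq: "(\<lambda>x. (\<Sum>m\<le>k. a m * ((x - z) / d) ^ m) * (\<Sum>l\<le>k. b l * ((x - z) / d) ^ l))
      = (\<lambda>x. \<Sum>m\<le>k. \<Sum>l\<le>k. a m * b l * ((x - z) / d) ^ (m + l))"
    by (simp add: sum_product power_add mult_ac)
  show "((\<lambda>x. (\<Sum>m\<le>k. a m * ((x - z) / d) ^ m) * (\<Sum>l\<le>k. b l * ((x - z) / d) ^ l))
      has_integral (\<Sum>m\<le>k. \<Sum>l\<le>k. a m * b l * (d * mass_mat k $$ (m, l)))) {z - d/2..z + d/2}"
    unfolding eq
  proof (intro has_integral_sum finite_atMost has_integral_mult_right)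
    fix m l assume "m \<in> {..k}" "l \<in> {..k}"
    then show "((\<lambda>x. ((x - z) / d) ^ (m + l)) has_integral d * mass_mat k $$ (m, l))
        {z - d/2..z + d/2}"
      using has_integral_scaled_monomial[OF assms, of z "m + l"] by (simp only: mass_mat_index atMost_iff)
  qed
qed

text \<open>A continuous nonnegative function with zero integral vanishes on the whole cell, whereas
  a polynomial with a nonzero coefficient has only finitely many roots.\<close>

lemma integral_scaled_poly_square_zero:
  fixes d z :: real
  assumes "d > 0" and "m \<le> k"
    and zero: "integral {z - d/2..z + d/2}
      (\<lambda>x. (\<Sum>m\<le>k. a m * ((x - z) / d) ^ m) * (\<Sum>m\<le>k. a m * ((x - z) / d) ^ m)) = 0"
  shows "a m = 0"
proof (rule ccontr)
  assume "a m \<noteq> 0"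
  then have fin: "finite {y. (\<Sum>i\<le>k. a i * y ^ i) = 0}"
    using \<open>m \<le> k\<close> by (subst polyfun_finite_roots) blast
  let ?g = "\<lambda>x. (\<Sum>m\<le>k. a m * ((x - z) / d) ^ m) * (\<Sum>m\<le>k. a m * ((x - z) / d) ^ m)"
  have cont: "continuous_on (cbox (z - d/2) (z + d/2)) ?g"
    using \<open>d > 0\<close> by (intro continuous_intros) auto
  then have int: "(?g has_integral 0) (cbox (z - d/2) (z + d/2))"
    using integrable_integral[OF integrable_continuous[OF cont]] zero by simp
  have root: "(\<Sum>m\<le>k. a m * ((x - z) / d) ^ m) = 0" if "x \<in> {z - d/2..z + d/2}" for x
    using has_integral_0_cbox_imp_0[OF cont _ int, of x] that \<open>d > 0\<close> by auto
  \<comment> \<open>The point \<open>y\<close> corresponds to \<open>z + d * y\<close> in the cell;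
    infinitely many roots in the scaled variable result.\<close>
  have "{-1/2..1/2} \<subseteq> {y. (\<Sum>i\<le>k. a i * y ^ i) = 0}"
  proof
    fix y :: real assume y: "y \<in> {-1/2..1/2}"
    have "d * y \<le> d * (1/2)" "d * (-1/2) \<le> d * y"
      using y \<open>d > 0\<close> by (intro mult_left_mono; simp)+
    then show "y \<in> {y. (\<Sum>i\<le>k. a i * y ^ i) = 0}"
      using root[of "z + d * y"] \<open>d > 0\<close> by simp
  qed
  then have "finite {-1/2..1/2::real}" using fin finite_subset by blast
  then show False using infinite_Icc[of "-1/2" "1/2::real"] by simp
qed

section \<open>Invertibility of the mass matrix\<close>

lemma mult_mat_vec_index_sum:
  assumes "X \<in> carrier_mat n m" "v \<in> carrier_vec m" "r < n"
  shows "(X *\<^sub>v v) $ r = (\<Sum>k<m. X $$ (r, k) * v $ k)"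
  using assms by (auto simp: scalar_prod_def atLeast0LessThan intro!: sum.cong)

text \<open>Injectivity makes the determinant nonzero, so \<open>mat_inverse\<close> does not return
  \<open>None\<close> and \<open>minv\<close> is a genuine inverse.\<close>

lemma minv_inverse:
  assumes "X \<in> carrier_mat n n"
    and "\<And>v. v \<in> carrier_vec n \<Longrightarrow> X *\<^sub>v v = 0\<^sub>v n \<Longrightarrow> v = 0\<^sub>v n"
  shows "X * minv X = 1\<^sub>m n" "minv X \<in> carrier_mat n n"
proof -
  have "det X \<noteq> 0" using det_0_iff_vec_prod_zero[OF assms(1)] assms(2) by auto
  then have "mat_inverse X \<noteq> None"
    using det_non_zero_imp_unit[OF assms(1), of "()"] mat_inverse(1)[OF assms(1), where b = "()"]
    by blast
  then obtain Y where "mat_inverse X = Some Y" by auto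
  then show "X * minv X = 1\<^sub>m n" "minv X \<in> carrier_mat n n"
    using mat_inverse(2)[OF assms(1)] by (auto simp: minv_def)
qed

text \<open>The entries of \<open>v\<close> are read as coefficients of a polynomial on a cell of
  length 1. The quadratic form of the mass matrix at \<open>v\<close> is the integral of its square,
  so it is definite. The factor \<open>d\<close> serves the nonlinear term, where
  \<open>dx G\<close> times the mass matrix is inverted.\<close>

lemma mass_mat_inj:
  assumes v: "v \<in> carrier_vec (k + 1)" and "d \<noteq> 0" and zero: "(d \<cdot>\<^sub>m mass_mat k) *\<^sub>v v = 0\<^sub>v (k + 1)"
  shows "v = 0\<^sub>v (k + 1)"
proof (rule eq_vecI)
  fix i assume "i < dim_vec (0\<^sub>v (k + 1))"
  then have i: "i \<le> k" by simp
  have row: "(\<Sum>l\<le>k. mass_mat k $$ (m, l) * v $ l) = 0" if "m \<le> k" for m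
  proof -
    have "((d \<cdot>\<^sub>m mass_mat k) *\<^sub>v v) $ m = (\<Sum>l<k+1. (d \<cdot>\<^sub>m mass_mat k) $$ (m, l) * v $ l)"
      using that v by (intro mult_mat_vec_index_sum[of _ "k + 1"]) (auto intro!: carrier_matI)
    also have "\<dots> = (\<Sum>l\<le>k. d * (mass_mat k $$ (m, l) * v $ l))"
      using that
      by (intro sum.cong) auto
    finally have "0 = d * (\<Sum>l\<le>k. mass_mat k $$ (m, l) * v $ l)"
      using zero that by (simp add: sum_distrib_left)
    then show ?thesis using \<open>d \<noteq> 0\<close> by simp
  qed
  \<comment> \<open>The factor 1 is the cell length in
    \<open>integral_prod_scaled_poly\<close>.\<close>
  have "(\<Sum>m\<le>k. \<Sum>l\<le>k. v $ m * v $ l * (1 * mass_mat k $$ (m, l)))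
      = (\<Sum>m\<le>k. v $ m * (\<Sum>l\<le>k. mass_mat k $$ (m, l) * v $ l))"
    by (simp add: sum_distrib_left mult_ac)
  also have "\<dots> = 0" using row by simp
  finally have "v $ i = 0"
    using integral_scaled_poly_square_zero[of 1 i k, where z = 0 and a = "\<lambda>m. v $ m"] i
      integral_prod_scaled_poly[of 1, where z = 0 and k = k and a = "\<lambda>m. v $ m" and b = "\<lambda>m. v $ m"]
    by simp
  then show "v $ i = 0\<^sub>v (k + 1) $ i" using i by simp
qed (use v in simp)

lemma minv_scaled_mass_mat:
  assumes "d \<noteq> 0"
  shows "(d \<cdot>\<^sub>m mass_mat k) * minv (d \<cdot>\<^sub>m mass_mat k) = 1\<^sub>m (k + 1)"
    "minv (d \<cdot>\<^sub>m mass_mat k) \<in> carrier_mat (k + 1) (k + 1)"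
  using minv_inverse[OF smult_carrier_mat[OF mass_mat_carrier] mass_mat_inj[OF _ assms]] by auto

lemma minv_mass_mat:
  "mass_mat k * minv (mass_mat k) = 1\<^sub>m (k + 1)" "minv (mass_mat k) \<in> carrier_mat (k + 1) (k + 1)"
proof -
  have "1 \<cdot>\<^sub>m mass_mat k = mass_mat k" by (intro eq_matI) auto
  then show "mass_mat k * minv (mass_mat k) = 1\<^sub>m (k + 1)"
    "minv (mass_mat k) \<in> carrier_mat (k + 1) (k + 1)"
    using minv_scaled_mass_mat[of 1 k] by auto
qed

section \<open>Skew-adjointness of the DG matrix\<close>

text \<open>The fractions \<open>i / (i + j)\<close> and \<open>j / (i + j)\<close> add up to 1, so
  their differences to 1/2 are opposite; the other factors depend on \<open>i + j\<close> only. The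
  corner entry, where the fraction would be 0/0, is set to 0 by definition.\<close>

lemma D1_mat_skew:
  assumes "i \<le> k" "j \<le> k"
  shows "D1_mat k $$ (i, j) = - D1_mat k $$ (j, i)"
proof (cases "i = 0 \<and> j = 0")
  case False
  then have pos: "real (i + j) \<noteq> 0" by (simp only: of_nat_eq_0_iff add_is_0) simp
  have D1: "D1_mat k $$ (p, q) = (1/2) ^ (p + q) * (real p / real (p + q) - 1/2) * (1 - (-1) ^ (p + q))"
    if "p \<le> k" "q \<le> k" "\<not> (p = 0 \<and> q = 0)" for p q
  proof -
    have "q + 1 + (p + 1) - 2 = p + q" by simp
    then show ?thesis using that by (simp only: D1_mat_def Let_def) (simp add: add.commute)
  qed
  have neg: "real i / real (i + j) - 1/2 = - (real j / real (i + j) - 1/2)"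
    using pos by (simp add: field_simps)
  have F: "\<not> (j = 0 \<and> i = 0)" using False by blast
  show ?thesis
    unfolding D1[OF assms False] D1[OF assms(2,1) F] add.commute[of j i] neg
    by (simp only: minus_mult_left minus_mult_right)
qed (simp add: D1_mat_def)

text \<open>The sign exponent is the 1-based column index in \<open>D2_mat\<close> and the 1-based
  row index minus one in \<open>D3_mat\<close>. After transposition the exponents differ by one,
  which gives the minus sign.\<close>

lemma D2_mat_transpose:
  assumes "i \<le> k" "j \<le> k"
  shows "D2_mat k $$ (i, j) = - D3_mat k $$ (j, i)"
  using assms by (simp add: D2_mat_def D3_mat_def add.commute)

text \<open>The Gram matrix of the whole DG basis for the L2 product. Multiplying the DG matrix by
  it from the left cancels both \<open>1 / dx G\<close> and the inverse mass matrix.\<close>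

definition gram_mat :: "vm_disc \<Rightarrow> real mat" where
  "gram_mat G = mat (ndof G) (ndof G) (\<lambda>(r, c).
     if r div (pdeg G + 1) = c div (pdeg G + 1)
     then dx G * mass_mat (pdeg G) $$ (r mod (pdeg G + 1), c mod (pdeg G + 1)) else 0)"

lemma gram_mat_dim [simp]: "dim_row (gram_mat G) = ndof G" "dim_col (gram_mat G) = ndof G"
  by (simp_all add: gram_mat_def)

lemma gram_mat_carrier: "gram_mat G \<in> carrier_mat (ndof G) (ndof G)"
  by auto

lemma dg_mat_dim [simp]: "dim_row (dg_mat G) = ndof G" "dim_col (dg_mat G) = ndof G"
  by (simp_all add: dg_mat_def)

lemma dg_mat_carrier: "dg_mat G \<in> carrier_mat (ndof G) (ndof G)"
  by auto

section \<open>Flat indices and cell-wise indices\<close>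

lemma sum_ndof: "(\<Sum>r<ndof G. f r) = (\<Sum>i<ncell G. \<Sum>l\<le>pdeg G. f (i * (pdeg G + 1) + l))"
proof -
  let ?K = "pdeg G + 1"
  have "(\<Sum>r<ndof G. f r) = (\<Sum>i<ncell G. sum f {i * ?K..<i * ?K + ?K})"
    by (simp only: sum.nat_group ndof_def mult.commute)
  also have "\<dots> = (\<Sum>i<ncell G. \<Sum>l<?K. f (i * ?K + l))"
  proof (rule sum.cong[OF refl])
    fix i
    show "sum f {i * ?K..<i * ?K + ?K} = (\<Sum>l<?K. f (i * ?K + l))"
      using sum.shift_bounds_nat_ivl[of f 0 "i * ?K" ?K]
      by (simp only: atLeast0LessThan add_0_left add.commute)
  qed
  also have "{..<?K} = {..pdeg G}" by auto
  finally show ?thesis .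
qed

lemma dof_less:
  assumes "i < ncell G" "l \<le> pdeg G"
  shows "i * (pdeg G + 1) + l < ndof G"
proof -
  have "i * (pdeg G + 1) + l < (i + 1) * (pdeg G + 1)" using assms by simp
  also have "\<dots> \<le> ncell G * (pdeg G + 1)" using assms by (intro mult_right_mono) auto
  finally show ?thesis by (simp add: ndof_def mult.commute)
qed

lemma dof_div_mod:
  assumes "l \<le> pdeg G"
  shows "(i * (pdeg G + 1) + l) div (pdeg G + 1) = i" "(i * (pdeg G + 1) + l) mod (pdeg G + 1) = l"
proof -
  have "(i * K + l) div K = i \<and> (i * K + l) mod K = l" if "l < K" for K
    using that by simp
  from this[of "pdeg G + 1"] show "(i * (pdeg G + 1) + l) div (pdeg G + 1) = i"
      "(i * (pdeg G + 1) + l) mod (pdeg G + 1) = l"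
    using assms by (simp_all only: less_Suc_eq_le Suc_eq_plus1[symmetric])
qed

lemma dof_less_cell: "r < ndof G \<Longrightarrow> r div (pdeg G + 1) < ncell G"
  by (simp add: ndof_def less_mult_imp_div_less mult.commute)

section \<open>The L2 product in coordinates\<close>

lemma cell_eq: "cell G i = {(real i + 1/2) * dx G - dx G / 2..(real i + 1/2) * dx G + dx G / 2}"
  by (simp add: cell_def algebra_simps)

lemma cell_fun_eq:
  "cell_fun G u i x = (\<Sum>m\<le>pdeg G. u $ (i * (pdeg G + 1) + m) * ((x - (real i + 1/2) * dx G) / dx G) ^ m)"
  unfolding cell_fun_def cell_coeffs_def xi_def by (intro sum.cong) auto

lemma dg_inner_gram:
  assumes "dx G > 0" "u \<in> carrier_vec (ndof G)" "w \<in> carrier_vec (ndof G)"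
  shows "dg_inner G u w = scalar_prod u (gram_mat G *\<^sub>v w)"
proof -
  let ?K = "pdeg G + 1" and ?M = "mass_mat (pdeg G)"
  have row: "(gram_mat G *\<^sub>v w) $ (i * ?K + m) = (\<Sum>l\<le>pdeg G. dx G * ?M $$ (m, l) * w $ (i * ?K + l))"
    if "i < ncell G" "m \<le> pdeg G" for i m
  proof -
    have "(gram_mat G *\<^sub>v w) $ (i * ?K + m)
        = (\<Sum>j<ncell G. \<Sum>l\<le>pdeg G. gram_mat G $$ (i * ?K + m, j * ?K + l) * w $ (j * ?K + l))"
      using mult_mat_vec_index_sum[OF gram_mat_carrier assms(3) dof_less[OF that]]
      by (simp only: sum_ndof)
    \<comment> \<open>Entries that couple different cells vanish, so only the block of cell
      \<open>i\<close> survives.\<close>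
    also have "\<dots> = (\<Sum>j<ncell G. if j = i then \<Sum>l\<le>pdeg G. dx G * ?M $$ (m, l) * w $ (j * ?K + l) else 0)"
      using that by (intro sum.cong refl)
        (auto simp: gram_mat_def dof_less[simplified] dof_div_mod[simplified] intro!: sum.neutral)
    also have "\<dots> = (\<Sum>l\<le>pdeg G. dx G * ?M $$ (m, l) * w $ (i * ?K + l))"
      using that by simp
    finally show ?thesis .
  qed
  have "dg_inner G u w = (\<Sum>i<ncell G. \<Sum>m\<le>pdeg G. \<Sum>l\<le>pdeg G.
      u $ (i * ?K + m) * w $ (i * ?K + l) * (dx G * ?M $$ (m, l)))"
    unfolding dg_inner_def cell_fun_eq cell_eq integral_prod_scaled_poly[OF assms(1)] ..
  also have "\<dots> = (\<Sum>i<ncell G. \<Sum>m\<le>pdeg G. u $ (i * ?K + m) * (gram_mat G *\<^sub>v w) $ (i * ?K + m))"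
    using row by (intro sum.cong refl) (auto simp: sum_distrib_left mult_ac)
  also have "\<dots> = (\<Sum>r<ndof G. u $ r * (gram_mat G *\<^sub>v w) $ r)"
    by (simp only: sum_ndof)
  also have "\<dots> = scalar_prod u (gram_mat G *\<^sub>v w)"
    by (simp only: scalar_prod_def atLeast0LessThan dim_mult_mat_vec gram_mat_dim)
  finally show ?thesis .
qed

text \<open>The product is a sum of nonnegative integrals over the cells, so each of them is zero,
  and on each cell the coefficients vanish by
  \<open>integral_scaled_poly_square_zero\<close>.\<close>

lemma dg_inner_definite:
  assumes "dx G > 0" and u: "u \<in> carrier_vec (ndof G)" and zero: "dg_inner G u u = 0"
  shows "u = 0\<^sub>v (ndof G)"
proof (rule eq_vecI)
  let ?K = "pdeg G + 1"
  fix r assume "r < dim_vec (0\<^sub>v (ndof G))"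
  then have r: "r < ndof G" by simp
  have int0: "integral (cell G i) (\<lambda>x. cell_fun G u i x * cell_fun G u i x) \<ge> 0" for i
  proof (rule integral_nonneg)
    show "(\<lambda>x. cell_fun G u i x * cell_fun G u i x) integrable_on cell G i"
      unfolding cell_fun_eq cell_eq using assms(1)
      by (intro integrable_continuous_real continuous_intros) auto
  qed auto
  have "\<forall>i\<in>{..<ncell G}. integral (cell G i) (\<lambda>x. cell_fun G u i x * cell_fun G u i x) = 0"
    using zero int0 unfolding dg_inner_def by (subst (asm) sum_nonneg_eq_0_iff) auto
  then have "integral (cell G (r div ?K)) (\<lambda>x. cell_fun G u (r div ?K) x * cell_fun G u (r div ?K) x) = 0"
    using dof_less_cell[OF r] by blast
  then have "u $ (r div ?K * ?K + r mod ?K) = 0"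
    unfolding cell_fun_eq cell_eq
    by (rule integral_scaled_poly_square_zero[OF assms(1), rotated]) (simp add: less_Suc_eq_le[symmetric])
  then show "u $ r = 0\<^sub>v (ndof G) $ r" using r by (simp only: div_mult_mod_eq index_zero_vec)
qed (use u in simp)

text \<open>The diagonal block of the Gram matrix meets the inverse mass matrix and the factor
  \<open>1 / dx G\<close>, and leaves the bare blocks. The three summands stay separate because they
  may fall on the same block when there are few cells.\<close>

lemma gram_mult_dg_mat:
  assumes "dx G > 0" and r: "r < ndof G" and c: "c < ndof G"
  defines "K \<equiv> pdeg G + 1"
  shows "(gram_mat G * dg_mat G) $$ (r, c) =
      (if c div K = r div K then D1_mat (pdeg G) $$ (r mod K, c mod K) else 0)
    + (if c div K = (r div K + 1) mod ncell G then D2_mat (pdeg G) $$ (r mod K, c mod K) else 0)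
    + (if r div K = (c div K + 1) mod ncell G then D3_mat (pdeg G) $$ (r mod K, c mod K) else 0)"
proof -
  let ?M = "mass_mat (pdeg G)" and ?Mi = "minv (mass_mat (pdeg G))"
  let ?i = "r div K" and ?l = "r mod K" and ?i' = "c div K" and ?m = "c mod K"
  have l: "?l \<le> pdeg G" and m: "?m \<le> pdeg G"
    by (simp_all add: K_def less_Suc_eq_le[symmetric])
  have MMi: "(\<Sum>p\<le>pdeg G. ?M $$ (?l, p) * (?Mi * D) $$ (p, ?m)) = D $$ (?l, ?m)"
    if D: "D \<in> carrier_mat (pdeg G + 1) (pdeg G + 1)" for D
  proof -
    have "?M * (?Mi * D) = D"
      using D minv_mass_mat[of "pdeg G"] mass_mat_carrier[of "pdeg G"]
      by (metis assoc_mult_mat left_mult_one_mat)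
    then have "D $$ (?l, ?m) = (?M * (?Mi * D)) $$ (?l, ?m)" by simp
    also have "\<dots> = (\<Sum>p<pdeg G + 1. ?M $$ (?l, p) * (?Mi * D) $$ (p, ?m))"
      using l m D minv_mass_mat(2)[of "pdeg G"]
      by (simp add: scalar_prod_def atLeast0LessThan)
    also have "{..<pdeg G + 1} = {..pdeg G}" by auto
    finally show ?thesis by simp
  qed
  have "(gram_mat G * dg_mat G) $$ (r, c) = (\<Sum>q<ndof G. gram_mat G $$ (r, q) * dg_mat G $$ (q, c))"
    using r c
    by (simp add: scalar_prod_def atLeast0LessThan)
  also have "\<dots> = (\<Sum>j<ncell G. \<Sum>p\<le>pdeg G. gram_mat G $$ (r, j * K + p) * dg_mat G $$ (j * K + p, c))"
    by (simp only: sum_ndof K_def)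
  also have "\<dots> = (\<Sum>j<ncell G. if j = ?i then \<Sum>p\<le>pdeg G. dx G * ?M $$ (?l, p) * dg_mat G $$ (j * K + p, c) else 0)"
    using r by (intro sum.cong refl)
      (auto simp: gram_mat_def K_def dof_less[simplified] dof_div_mod[simplified] intro!: sum.neutral)
  also have "\<dots> = (\<Sum>p\<le>pdeg G. dx G * ?M $$ (?l, p) * dg_mat G $$ (?i * K + p, c))"
    using dof_less_cell[OF r] by (simp add: K_def)
  also have "\<dots> = (\<Sum>p\<le>pdeg G. ?M $$ (?l, p) * (
      (if ?i' = ?i then (?Mi * D1_mat (pdeg G)) $$ (p, ?m) else 0)
    + (if ?i' = (?i + 1) mod ncell G then (?Mi * D2_mat (pdeg G)) $$ (p, ?m) else 0)
    + (if ?i = (?i' + 1) mod ncell G then (?Mi * D3_mat (pdeg G)) $$ (p, ?m) else 0)))"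
  proof (intro sum.cong refl)
    fix p assume "p \<in> {..pdeg G}"
    then have p: "p \<le> pdeg G" by simp
    show "dx G * ?M $$ (?l, p) * dg_mat G $$ (?i * K + p, c) = ?M $$ (?l, p) * (
      (if ?i' = ?i then (?Mi * D1_mat (pdeg G)) $$ (p, ?m) else 0)
    + (if ?i' = (?i + 1) mod ncell G then (?Mi * D2_mat (pdeg G)) $$ (p, ?m) else 0)
    + (if ?i = (?i' + 1) mod ncell G then (?Mi * D3_mat (pdeg G)) $$ (p, ?m) else 0))"
      using dof_less[OF dof_less_cell[OF r] p] c assms(1)
      unfolding dg_mat_def Let_def K_def
      by (simp add: dof_div_mod[OF p, simplified])
  qed
  also have "\<dots> =
      (if ?i' = ?i then \<Sum>p\<le>pdeg G. ?M $$ (?l, p) * (?Mi * D1_mat (pdeg G)) $$ (p, ?m) else 0)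
    + (if ?i' = (?i + 1) mod ncell G then \<Sum>p\<le>pdeg G. ?M $$ (?l, p) * (?Mi * D2_mat (pdeg G)) $$ (p, ?m) else 0)
    + (if ?i = (?i' + 1) mod ncell G then \<Sum>p\<le>pdeg G. ?M $$ (?l, p) * (?Mi * D3_mat (pdeg G)) $$ (p, ?m) else 0)"
    by (simp add: distrib_left sum.distrib)
  also have "\<dots> = (if ?i' = ?i then D1_mat (pdeg G) $$ (?l, ?m) else 0)
    + (if ?i' = (?i + 1) mod ncell G then D2_mat (pdeg G) $$ (?l, ?m) else 0)
    + (if ?i = (?i' + 1) mod ncell G then D3_mat (pdeg G) $$ (?l, ?m) else 0)"
    by (subst (1 2 3) MMi) (auto simp: D1_mat_def D2_mat_def D3_mat_def)
  finally show ?thesis .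
qed

text \<open>Exchanging \<open>r\<close> and \<open>c\<close> keeps the condition of the first
  summand and swaps those of the other two. So skewness of \<open>D1_mat\<close> and the relation
  between \<open>D2_mat\<close> and \<open>D3_mat\<close> settle the claim summand by summand, for
  any number of cells.\<close>

lemma gram_mult_dg_mat_skew:
  assumes "dx G > 0"
  shows "transpose_mat (gram_mat G * dg_mat G) = - (gram_mat G * dg_mat G)"
proof (rule eq_matI)
  let ?K = "pdeg G + 1"
  have dims: "dim_row (gram_mat G * dg_mat G) = ndof G" "dim_col (gram_mat G * dg_mat G) = ndof G"
    by auto
  fix r c
  assume "r < dim_row (- (gram_mat G * dg_mat G))" "c < dim_col (- (gram_mat G * dg_mat G))"
  then have r: "r < ndof G" and c: "c < ndof G" using dims by auto
  have l: "r mod ?K \<le> pdeg G" and m: "c mod ?K \<le> pdeg G"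
    by (simp_all add: less_Suc_eq_le[symmetric])
  have "(gram_mat G * dg_mat G) $$ (c, r) = - (gram_mat G * dg_mat G) $$ (r, c)"
    unfolding gram_mult_dg_mat[OF assms r c] gram_mult_dg_mat[OF assms c r]
    using D1_mat_skew[OF l m] D2_mat_transpose[OF l m] D2_mat_transpose[OF m l] by auto
  then show "transpose_mat (gram_mat G * dg_mat G) $$ (r, c) = (- (gram_mat G * dg_mat G)) $$ (r, c)"
    using r c dims by simp
qed auto

text \<open>The range of the DG matrix is orthogonal to its kernel: moving the skew matrix
  \<open>?S\<close> from \<open>u\<close> to \<open>w\<close> costs only a sign, and
  \<open>?S\<close> annihilates \<open>w\<close>.\<close>

lemma dg_inner_dg_mat_kernel:
  assumes "dx G > 0" "u \<in> carrier_vec (ndof G)" "w \<in> mat_kernel (dg_mat G)"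
  shows "dg_inner G w (dg_mat G *\<^sub>v u) = 0"
proof -
  let ?S = "gram_mat G * dg_mat G"
  have w: "w \<in> carrier_vec (ndof G)" "dg_mat G *\<^sub>v w = 0\<^sub>v (ndof G)"
    using mat_kernelD[OF dg_mat_carrier assms(3)] by auto
  have S: "?S \<in> carrier_mat (ndof G) (ndof G)" by (rule mult_carrier_mat[OF gram_mat_carrier dg_mat_carrier])
  have Sw: "?S *\<^sub>v w = 0\<^sub>v (ndof G)"
    using w by (auto simp: assoc_mult_mat_vec[OF gram_mat_carrier dg_mat_carrier] scalar_prod_def
        intro!: eq_vecI)
  have "dg_inner G w (dg_mat G *\<^sub>v u) = scalar_prod w (?S *\<^sub>v u)"
    using assms w by (subst dg_inner_gram)
      (auto simp: assoc_mult_mat_vec[OF gram_mat_carrier dg_mat_carrier] intro: mult_mat_vec_carrier[OF dg_mat_carrier])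
  also have "\<dots> = scalar_prod (transpose_mat ?S *\<^sub>v w) u"
    using transpose_vec_mult_scalar[OF S assms(2) w(1)] by simp
  also have "\<dots> = 0"
    using S w(1) assms(2) by (simp add: gram_mult_dg_mat_skew[OF assms(1)] Sw uminus_mult_mat_vec)
  finally show ?thesis .
qed

section \<open>The projection onto the kernel\<close>

lemma kernel_projectionD:
  assumes "kernel_projection G P"
  shows "P \<in> carrier_mat (ndof G) (ndof G)"
    and "u \<in> carrier_vec (ndof G) \<Longrightarrow> P *\<^sub>v u \<in> carrier_vec (ndof G)"
    and "u \<in> carrier_vec (ndof G) \<Longrightarrow> P *\<^sub>v u \<in> mat_kernel (dg_mat G)"
    and "u \<in> carrier_vec (ndof G) \<Longrightarrow> w \<in> mat_kernel (dg_mat G) \<Longrightarrow> dg_inner G (u - P *\<^sub>v u) w = 0"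
  using assms unfolding kernel_projection_def by auto

text \<open>The difference \<open>w - P *\<^sub>v w\<close> lies in the kernel and is orthogonal to
  it, hence to itself.\<close>

lemma kernel_projection_fixes_kernel:
  assumes "dx G > 0" "kernel_projection G P" and w: "w \<in> mat_kernel (dg_mat G)"
  shows "P *\<^sub>v w = w"
proof -
  note P = kernel_projectionD[OF assms(2)]
  have wc: "w \<in> carrier_vec (ndof G)" and Aw: "dg_mat G *\<^sub>v w = 0\<^sub>v (ndof G)"
    using mat_kernelD[OF dg_mat_carrier w] by auto
  have APw: "dg_mat G *\<^sub>v (P *\<^sub>v w) = 0\<^sub>v (ndof G)"
    using mat_kernelD[OF dg_mat_carrier P(3)[OF wc]] by auto
  have "w - P *\<^sub>v w \<in> mat_kernel (dg_mat G)"
    using wc P(2)[OF wc] mult_minus_distrib_mat_vec[OF dg_mat_carrier wc P(2)[OF wc]]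
    by (intro mat_kernelI[OF dg_mat_carrier]) (auto simp: Aw APw)
  then have "w - P *\<^sub>v w = 0\<^sub>v (ndof G)"
    using P(4)[OF wc] wc P(2)[OF wc] by (intro dg_inner_definite[OF assms(1)]) auto
  show ?thesis
  proof (rule eq_vecI)
    fix i assume "i < dim_vec w"
    moreover have "(w - P *\<^sub>v w) $ i = 0\<^sub>v (ndof G) $ i"
      by (simp only: \<open>w - P *\<^sub>v w = 0\<^sub>v (ndof G)\<close>)
    ultimately show "(P *\<^sub>v w) $ i = w $ i" using wc P(1) by simp
  qed (use wc P(1) in auto)
qed

text \<open>The projected vector \<open>?y\<close> lies in the kernel. It is orthogonal to
  \<open>?a\<close> by skew-adjointness and to \<open>?a - ?y\<close> by the projection property,
  hence to itself.\<close>

lemma kernel_projection_dg_mat_vec: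
  assumes "dx G > 0" "kernel_projection G P" and u: "u \<in> carrier_vec (ndof G)"
  shows "P *\<^sub>v (dg_mat G *\<^sub>v u) = 0\<^sub>v (ndof G)"
proof (rule dg_inner_definite[OF assms(1)])
  note P = kernel_projectionD[OF assms(2)]
  let ?a = "dg_mat G *\<^sub>v u"
  let ?y = "P *\<^sub>v ?a"
  have a: "?a \<in> carrier_vec (ndof G)" using u by (intro mult_mat_vec_carrier[OF dg_mat_carrier])
  show y: "?y \<in> carrier_vec (ndof G)" using P(2)[OF a] .
  have Qy: "gram_mat G *\<^sub>v ?y \<in> carrier_vec (ndof G)"
    using y by (intro mult_mat_vec_carrier[OF gram_mat_carrier])
  have "dg_inner G ?a ?y = dg_inner G ?y ?a"
    by (simp only: dg_inner_def mult.commute)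
  also have "\<dots> = 0" using dg_inner_dg_mat_kernel[OF assms(1) u P(3)[OF a]] .
  finally have "dg_inner G ?a ?y = 0" .
  moreover have "dg_inner G (?a - ?y) ?y = 0" using P(4)[OF a P(3)[OF a]] .
  moreover have "dg_inner G (?a - ?y) ?y = dg_inner G ?a ?y - dg_inner G ?y ?y"
    using minus_scalar_prod_distrib[OF a y Qy] dg_inner_gram[OF assms(1) a y]
      dg_inner_gram[OF assms(1) y y] dg_inner_gram[OF assms(1) minus_carrier_vec[OF a y] y] by simp
  ultimately show "dg_inner G ?y ?y = 0" by simp
qed

text \<open>The vector statement is applied to unit vectors, column by column. The matrix form is
  the one needed for the powers in the exponential series.\<close>

lemma kernel_projection_dg_mat:
  assumes "dx G > 0" "kernel_projection G P"
  shows "P * dg_mat G = 0\<^sub>m (ndof G) (ndof G)"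
proof (rule eq_matI)
  note P = kernel_projectionD(1)[OF assms(2)]
  fix r c assume "r < dim_row (0\<^sub>m (ndof G) (ndof G) :: real mat)" "c < dim_col (0\<^sub>m (ndof G) (ndof G) :: real mat)"
  then have rc: "r < ndof G" "c < ndof G" by auto
  have "(P * dg_mat G) *\<^sub>v unit_vec (ndof G) c = 0\<^sub>v (ndof G)"
    using kernel_projection_dg_mat_vec[OF assms unit_vec_carrier]
      assoc_mult_mat_vec[OF P dg_mat_carrier unit_vec_carrier] by simp
  then have "((P * dg_mat G) *\<^sub>v unit_vec (ndof G) c) $ r = 0" using rc by simp
  then show "(P * dg_mat G) $$ (r, c) = 0\<^sub>m (ndof G) (ndof G) $$ (r, c)"
    using rc P by (simp add: scalar_prod_right_unit)
qed (use kernel_projectionD(1)[OF assms(2)] in auto)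

text \<open>Applying \<open>P\<close> to the equation removes the DG part and leaves
  \<open>P *\<^sub>v u\<close>, which is therefore zero. Then \<open>u\<close> is in the kernel,
  where \<open>P\<close> is the identity.\<close>

lemma dg_mat_plus_projection_inj:
  assumes "dx G > 0" "kernel_projection G P" and u: "u \<in> carrier_vec (ndof G)"
    and zero: "(dg_mat G + P) *\<^sub>v u = 0\<^sub>v (ndof G)"
  shows "u = 0\<^sub>v (ndof G)"
proof -
  note P = kernel_projectionD[OF assms(2)]
  have a: "dg_mat G *\<^sub>v u \<in> carrier_vec (ndof G)"
    using u by (intro mult_mat_vec_carrier[OF dg_mat_carrier])
  have sum: "dg_mat G *\<^sub>v u + P *\<^sub>v u = 0\<^sub>v (ndof G)"
    using zero add_mult_distrib_mat_vec[OF dg_mat_carrier P(1) u] by simp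
  have "P *\<^sub>v u = P *\<^sub>v (dg_mat G *\<^sub>v u) + P *\<^sub>v (P *\<^sub>v u)"
    using kernel_projection_dg_mat_vec[OF assms(1,2) u]
      kernel_projection_fixes_kernel[OF assms(1,2) P(3)[OF u]] P(2)[OF u] by simp
  also have "\<dots> = P *\<^sub>v (dg_mat G *\<^sub>v u + P *\<^sub>v u)"
    using mult_add_distrib_mat_vec[OF P(1) a P(2)[OF u]] by simp
  also have "\<dots> = 0\<^sub>v (ndof G)"
    using P(1) by (auto simp: sum scalar_prod_def intro!: eq_vecI)
  finally have Pu: "P *\<^sub>v u = 0\<^sub>v (ndof G)" .
  then have "dg_mat G *\<^sub>v u = 0\<^sub>v (ndof G)" using sum a by simp
  then have "u \<in> mat_kernel (dg_mat G)" by (intro mat_kernelI[OF dg_mat_carrier u])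
  then show ?thesis using kernel_projection_fixes_kernel[OF assms(1,2)] Pu by simp
qed

section \<open>The matrix exponential\<close>

lemma pow_mat_index_Suc:
  assumes "X \<in> carrier_mat n n" "r < n" "c < n"
  shows "(X ^\<^sub>m Suc p) $$ (r, c) = (\<Sum>k<n. (X ^\<^sub>m p) $$ (r, k) * X $$ (k, c))"
  using assms by (auto simp: scalar_prod_def atLeast0LessThan intro!: sum.cong)

text \<open>The sum of the absolute values of all entries is a submultiplicative norm that dominates
  each entry.\<close>

lemma pow_mat_index_bound:
  fixes X :: "real mat"
  assumes X: "X \<in> carrier_mat n n" and "r < n" "c < n"
  shows "\<bar>(X ^\<^sub>m p) $$ (r, c)\<bar> \<le> (\<Sum>i<n. \<Sum>j<n. \<bar>X $$ (i, j)\<bar>) ^ p"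
  using assms(3)
proof (induction p arbitrary: c)
  case 0
  then show ?case using assms by auto
next
  case (Suc p)
  let ?C = "\<Sum>i<n. \<Sum>j<n. \<bar>X $$ (i, j)\<bar>"
  have "\<bar>(X ^\<^sub>m Suc p) $$ (r, c)\<bar> \<le> (\<Sum>k<n. \<bar>(X ^\<^sub>m p) $$ (r, k)\<bar> * \<bar>X $$ (k, c)\<bar>)"
    unfolding pow_mat_index_Suc[OF X \<open>r < n\<close> \<open>c < n\<close>]
    by (rule order_trans[OF sum_abs]) (simp add: abs_mult)
  \<comment> \<open>The entry in column \<open>c\<close> is enlarged to its whole row sum, so that
    summing over \<open>k\<close> produces another factor \<open>?C\<close>.\<close>
  also have "\<dots> \<le> (\<Sum>k<n. ?C ^ p * (\<Sum>j<n. \<bar>X $$ (k, j)\<bar>))"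
    using Suc by (intro sum_mono mult_mono member_le_sum[of c "{..<n}" "\<lambda>j. \<bar>X $$ (k, j)\<bar>" for k])
      (auto intro!: sum_nonneg zero_le_power)
  also have "\<dots> = ?C ^ Suc p" by (simp add: sum_distrib_left[symmetric])
  finally show ?case .
qed

lemma summable_matexp:
  fixes X :: "real mat"
  assumes "X \<in> carrier_mat n n" "r < n" "c < n"
  shows "summable (\<lambda>p. (X ^\<^sub>m p) $$ (r, c) / fact p)"
proof (rule summable_comparison_test)
  let ?C = "\<Sum>i<n. \<Sum>j<n. \<bar>X $$ (i, j)\<bar>"
  show "summable (\<lambda>p. ?C ^ p / fact p)"
    using summable_exp[of ?C] by (simp add: divide_inverse mult.commute)
  show "\<exists>N. \<forall>p\<ge>N. norm ((X ^\<^sub>m p) $$ (r, c) / fact p) \<le> ?C ^ p / fact p"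
    using pow_mat_index_bound[OF assms] by (auto intro!: divide_right_mono)
qed

lemma matexp_carrier: "X \<in> carrier_mat n n \<Longrightarrow> matexp X \<in> carrier_mat n n"
  by (auto simp: matexp_def)

text \<open>All powers of \<open>X\<close> except the zeroth are annihilated by \<open>P\<close>, so
  only the first term of the series survives.\<close>

lemma mult_matexp_annihilator:
  assumes P: "P \<in> carrier_mat n n" and X: "X \<in> carrier_mat n n" and PX: "P * X = 0\<^sub>m n n"
  shows "P * matexp X = P"
proof (rule eq_matI)
  fix r c assume "r < dim_row P" "c < dim_col P"
  then have rc: "r < n" "c < n" using P by auto
  have PXp: "(\<Sum>k<n. P $$ (r, k) * (X ^\<^sub>m p) $$ (k, c)) = (if p = 0 then P $$ (r, c) else 0)" for p
  proof -
    have "(P * X ^\<^sub>m p) = (if p = 0 then P else 0\<^sub>m n n)"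
    proof (induction p)
      case (Suc p)
      have Xp: "X ^\<^sub>m p \<in> carrier_mat n n" using X by (auto intro!: carrier_matI)
      have "P * X ^\<^sub>m Suc p = (P * X ^\<^sub>m p) * X"
        using assoc_mult_mat[OF P Xp X] by simp
      then show ?case using Suc X PX by auto
    qed (use P X in auto)
    then have "(P * X ^\<^sub>m p) $$ (r, c) = (if p = 0 then P $$ (r, c) else 0)" using rc by simp
    then show ?thesis using rc P X by (simp add: scalar_prod_def atLeast0LessThan)
  qed
  have "(P * matexp X) $$ (r, c) = (\<Sum>k<n. P $$ (r, k) * (\<Sum>p. (X ^\<^sub>m p) $$ (k, c) / fact p))"
    using rc P X by (simp add: scalar_prod_def atLeast0LessThan matexp_def)
  also have "\<dots> = (\<Sum>k<n. \<Sum>p. P $$ (r, k) * ((X ^\<^sub>m p) $$ (k, c) / fact p))"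
    using summable_matexp[OF X _ rc(2)] by (intro sum.cong refl suminf_mult[symmetric]) auto
  \<comment> \<open>Series and finite sum may be exchanged because every entry series
    converges.\<close>
  also have "\<dots> = (\<Sum>p. \<Sum>k<n. P $$ (r, k) * ((X ^\<^sub>m p) $$ (k, c) / fact p))"
    using summable_matexp[OF X _ rc(2)] by (intro suminf_sum[symmetric] summable_mult) auto
  also have "\<dots> = (\<Sum>p. if p = 0 then P $$ (r, c) else 0)"
  proof (rule suminf_cong)
    fix p
    have "(\<Sum>k<n. P $$ (r, k) * ((X ^\<^sub>m p) $$ (k, c) / fact p))
        = (\<Sum>k<n. P $$ (r, k) * (X ^\<^sub>m p) $$ (k, c)) / fact p"
      by (simp add: sum_divide_distrib)
    also have "\<dots> = (if p = 0 then P $$ (r, c) else 0)" by (simp add: PXp)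
    finally show "(\<Sum>k<n. P $$ (r, k) * ((X ^\<^sub>m p) $$ (k, c) / fact p)) = (if p = 0 then P $$ (r, c) else 0)" .
  qed
  also have "\<dots> = P $$ (r, c)" using suminf_finite[of "{0::nat}" "\<lambda>p. if p = 0 then P $$ (r, c) else 0"] by simp
  finally show "(P * matexp X) $$ (r, c) = P $$ (r, c)" .
qed (use P X in \<open>auto simp: matexp_def\<close>)

lemma expA_carrier: "expA G t \<in> carrier_mat (ndof G) (ndof G)"
  unfolding expA_def by (intro matexp_carrier smult_carrier_mat dg_mat_carrier)

lemma kernel_projection_expA:
  assumes "dx G > 0" "kernel_projection G P" "u \<in> carrier_vec (ndof G)"
  shows "P *\<^sub>v (expA G t *\<^sub>v u) = P *\<^sub>v u"
proof -
  note P = kernel_projectionD(1)[OF assms(2)]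
  have "P * (t \<cdot>\<^sub>m dg_mat G) = 0\<^sub>m (ndof G) (ndof G)"
    using mult_smult_distrib[OF P dg_mat_carrier, of t] kernel_projection_dg_mat[OF assms(1,2)] by auto
  then have "P * expA G t = P"
    unfolding expA_def using P dg_mat_carrier by (intro mult_matexp_annihilator) auto
  then show ?thesis using assoc_mult_mat_vec[OF P expA_carrier assms(3), of t] by simp
qed

section \<open>One step of the scheme\<close>

definition vec_incr :: "nat \<Rightarrow> real vec \<Rightarrow> real \<Rightarrow> nat set \<Rightarrow> (nat \<Rightarrow> real) \<Rightarrow> (nat \<Rightarrow> real vec) \<Rightarrow> real vec" where
  "vec_incr n u h Q w z = vec n (\<lambda>r. u $ r + h * (\<Sum>q\<in>Q. w q * z q $ r))"

lemma add_incr_sel: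
  "sf (add_incr G U h Q w V) j1 j2 = vec_incr (ndof G) (sf U j1 j2) h Q w (\<lambda>q. sf (V q) j1 j2)"
  "sE1 (add_incr G U h Q w V) = vec_incr (ndof G) (sE1 U) h Q w (\<lambda>q. sE1 (V q))"
  by (simp_all add: add_incr_def vec_incr_def Let_def)

text \<open>\<open>add_incr\<close> rebuilds every component with \<open>vec (ndof G)\<close>, which
  fixes the dimensions.\<close>

lemma vm_state_wf_add_incr: "vm_state_wf G (add_incr G U h Q w V)"
  by (simp add: vm_state_wf_def add_incr_def Let_def)

lemma mult_mat_vec_incr:
  assumes "X \<in> carrier_mat n n" "u \<in> carrier_vec n" "\<And>q. q \<in> Q \<Longrightarrow> z q \<in> carrier_vec n"
  shows "X *\<^sub>v vec_incr n u h Q w z = vec_incr n (X *\<^sub>v u) h Q w (\<lambda>q. X *\<^sub>v z q)"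
proof (rule eq_vecI)
  fix r assume "r < dim_vec (vec_incr n (X *\<^sub>v u) h Q w (\<lambda>q. X *\<^sub>v z q))"
  then have r: "r < n" by (simp add: vec_incr_def)
  have "(X *\<^sub>v vec_incr n u h Q w z) $ r
      = (\<Sum>k<n. X $$ (r, k) * (u $ k + h * (\<Sum>q\<in>Q. w q * z q $ k)))"
    using mult_mat_vec_index_sum[OF assms(1) _ r, of "vec_incr n u h Q w z"] by (simp add: vec_incr_def)
  also have "\<dots> = (\<Sum>k<n. X $$ (r, k) * u $ k) + (\<Sum>k<n. \<Sum>q\<in>Q. h * (w q * (X $$ (r, k) * z q $ k)))"
    by (simp add: distrib_left sum.distrib sum_distrib_left mult_ac)
  also have "\<dots> = (\<Sum>k<n. X $$ (r, k) * u $ k) + h * (\<Sum>q\<in>Q. w q * (\<Sum>k<n. X $$ (r, k) * z q $ k))"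
    by (subst sum.swap) (simp add: sum_distrib_left)
  also have "\<dots> = (X *\<^sub>v u) $ r + h * (\<Sum>q\<in>Q. w q * (X *\<^sub>v z q) $ r)"
    using mult_mat_vec_index_sum[OF assms(1) _ r] assms(2,3) by simp
  finally show "(X *\<^sub>v vec_incr n u h Q w z) $ r = vec_incr n (X *\<^sub>v u) h Q w (\<lambda>q. X *\<^sub>v z q) $ r"
    using r by (simp add: vec_incr_def)
qed (use assms(1) in \<open>simp add: vec_incr_def\<close>)

lemma vel_sum_carrier [simp]: "vel_sum G F \<in> carrier_vec (ndof G)"
  by (simp add: vel_sum_def)

lemma vel_sum_dim [simp]: "dim_vec (vel_sum G F) = ndof G"
  by (simp add: vel_sum_def)

lemma vel_sum_cong:
  assumes "\<And>j1 j2. j1 \<in> {1..nv1 G} \<Longrightarrow> j2 \<in> {1..nv2 G} \<Longrightarrow> F j1 j2 = H j1 j2"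
  shows "vel_sum G F = vel_sum G H"
  unfolding vel_sum_def using assms by (intro eq_vecI) (auto intro!: sum.cong)

lemma vel_sum_incr:
  "vel_sum G (\<lambda>j1 j2. vec_incr (ndof G) (F j1 j2) h Q w (\<lambda>q. Z q j1 j2))
    = vec_incr (ndof G) (vel_sum G F) h Q w (\<lambda>q. vel_sum G (Z q))"
proof (rule eq_vecI)
  fix r assume "r < dim_vec (vec_incr (ndof G) (vel_sum G F) h Q w (\<lambda>q. vel_sum G (Z q)))"
  then have r: "r < ndof G" by (simp add: vec_incr_def)
  have "(\<Sum>j1 = 1..nv1 G. \<Sum>j2 = 1..nv2 G. h * (\<Sum>q\<in>Q. w q * Z q j1 j2 $ r))
      = (\<Sum>j1 = 1..nv1 G. h * (\<Sum>q\<in>Q. w q * (\<Sum>j2 = 1..nv2 G. Z q j1 j2 $ r)))"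
    by (intro sum.cong refl) (simp add: sum_distrib_left sum.swap[of _ Q])
  also have "\<dots> = h * (\<Sum>q\<in>Q. w q * (\<Sum>j1 = 1..nv1 G. \<Sum>j2 = 1..nv2 G. Z q j1 j2 $ r))"
    by (simp add: sum_distrib_left sum.swap[of _ Q])
  finally show "vel_sum G (\<lambda>j1 j2. vec_incr (ndof G) (F j1 j2) h Q w (\<lambda>q. Z q j1 j2)) $ r
      = vec_incr (ndof G) (vel_sum G F) h Q w (\<lambda>q. vel_sum G (Z q)) $ r"
    using r by (simp add: vel_sum_def vec_incr_def sum.distrib)
qed (simp add: vec_incr_def)

text \<open>A difference of vectors takes its dimension from the second operand, hence the
  assumption on \<open>H\<close>.\<close>

lemma vel_sum_diff:
  assumes "\<And>j1 j2. j1 \<in> {1..nv1 G} \<Longrightarrow> j2 \<in> {1..nv2 G} \<Longrightarrow> H j1 j2 \<in> carrier_vec (ndof G)"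
  shows "vel_sum G (\<lambda>j1 j2. F j1 j2 - H j1 j2) = vel_sum G F - vel_sum G H"
proof (rule eq_vecI)
  fix r assume "r < dim_vec (vel_sum G F - vel_sum G H)"
  then have r: "r < ndof G" by simp
  have "(\<Sum>j1 = 1..nv1 G. \<Sum>j2 = 1..nv2 G. (F j1 j2 - H j1 j2) $ r)
      = (\<Sum>j1 = 1..nv1 G. \<Sum>j2 = 1..nv2 G. F j1 j2 $ r - H j1 j2 $ r)"
    using carrier_vecD[OF assms] r by (intro sum.cong refl index_minus_vec) simp_all
  then show "vel_sum G (\<lambda>j1 j2. F j1 j2 - H j1 j2) $ r = (vel_sum G F - vel_sum G H) $ r"
    using r by (simp add: vel_sum_def sum_subtractf)
qed simp

lemma vel_sum_smult:
  assumes "\<And>j1 j2. j1 \<in> {1..nv1 G} \<Longrightarrow> j2 \<in> {1..nv2 G} \<Longrightarrow> F j1 j2 \<in> carrier_vec (ndof G)"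
  shows "vel_sum G (\<lambda>j1 j2. a \<cdot>\<^sub>v F j1 j2) = a \<cdot>\<^sub>v vel_sum G F"
proof (rule eq_vecI)
  fix r assume "r < dim_vec (a \<cdot>\<^sub>v vel_sum G F)"
  then have r: "r < ndof G" by simp
  have "(\<Sum>j1 = 1..nv1 G. \<Sum>j2 = 1..nv2 G. (a \<cdot>\<^sub>v F j1 j2) $ r)
      = (\<Sum>j1 = 1..nv1 G. \<Sum>j2 = 1..nv2 G. a * F j1 j2 $ r)"
    using carrier_vecD[OF assms] r by (intro sum.cong refl index_smult_vec) simp_all
  then show "vel_sum G (\<lambda>j1 j2. a \<cdot>\<^sub>v F j1 j2) $ r = (a \<cdot>\<^sub>v vel_sum G F) $ r"
    using r by (simp add: vel_sum_def sum_distrib_left)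
qed simp

lemma mult_mat_vel_sum:
  assumes X: "X \<in> carrier_mat (ndof G) (ndof G)"
    and F: "\<And>j1 j2. j1 \<in> {1..nv1 G} \<Longrightarrow> j2 \<in> {1..nv2 G} \<Longrightarrow> F j1 j2 \<in> carrier_vec (ndof G)"
  shows "X *\<^sub>v vel_sum G F = vel_sum G (\<lambda>j1 j2. X *\<^sub>v F j1 j2)"
proof (rule eq_vecI)
  fix r assume "r < dim_vec (vel_sum G (\<lambda>j1 j2. X *\<^sub>v F j1 j2))"
  then have r: "r < ndof G" by simp
  have "(\<Sum>j1 = 1..nv1 G. \<Sum>j2 = 1..nv2 G. (X *\<^sub>v F j1 j2) $ r)
      = (\<Sum>j1 = 1..nv1 G. \<Sum>j2 = 1..nv2 G. \<Sum>k<ndof G. X $$ (r, k) * F j1 j2 $ k)"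
    using F by (intro sum.cong refl mult_mat_vec_index_sum[OF X _ r]) auto
  also have "\<dots> = (\<Sum>k<ndof G. X $$ (r, k) * (\<Sum>j1 = 1..nv1 G. \<Sum>j2 = 1..nv2 G. F j1 j2 $ k))"
    by (simp add: sum_distrib_left sum.swap[of _ _ "{..<ndof G}"])
  finally show "(X *\<^sub>v vel_sum G F) $ r = vel_sum G (\<lambda>j1 j2. X *\<^sub>v F j1 j2) $ r"
    using mult_mat_vec_index_sum[OF X vel_sum_carrier r] r by (simp add: vel_sum_def)
qed (use X in simp)

section \<open>The nonlinear term and the charge density\<close>

lemma mult_mat_carrier:
  assumes "dx G > 0"
  shows "mult_mat G g \<in> carrier_mat (ndof G) (ndof G)"
  \<comment> \<open>A positive cell length makes the scaled mass matrix invertible, so that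
    \<open>minv\<close> has the expected size.\<close>
  using minv_scaled_mass_mat(2)[of "dx G" "pdeg G"] assms
  by (intro carrier_matI) (simp_all add: mult_mat_def dim_diag_block_mat o_def ndof_def sum_list_triv)

lemma vm_N_sf_carrier:
  assumes "dx G > 0"
  shows "sf (vm_N G U) j1 j2 \<in> carrier_vec (ndof G)"
  using carrier_matD(1)[OF mult_mat_carrier[OF assms]] by (intro carrier_vecI) (simp add: vm_N_def)

text \<open>The matrix in front of the first difference depends on \<open>j2\<close> only, the one
  in front of the second on \<open>j1\<close> only. Each can be pulled out of the sum over the
  differenced index, which vanishes by conservativity.\<close>

lemma vel_sum_vm_N:
  assumes "dx G > 0" "fd_conservative G" "vm_state_wf G U"
  shows "vel_sum G (sf (vm_N G U)) = 0\<^sub>v (ndof G)"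
proof (rule eq_vecI)
  let ?f = "sf U"
  let ?X = "\<lambda>j2. mult_mat G (sE1 U) + v2 G j2 \<cdot>\<^sub>m mult_mat G (sB U)"
  let ?Y = "\<lambda>j1. mult_mat G (sE2 U) - v1 G j1 \<cdot>\<^sub>m mult_mat G (sB U)"
  have X: "?X j2 \<in> carrier_mat (ndof G) (ndof G)" and Y: "?Y j1 \<in> carrier_mat (ndof G) (ndof G)" for j1 j2
    using carrier_matD[OF mult_mat_carrier[OF assms(1)]] by (auto intro!: carrier_matI)
  have fd: "FD1 G ?f j1 j2 \<in> carrier_vec (ndof G)" "FD2 G ?f j1 j2 \<in> carrier_vec (ndof G)" for j1 j2
    by (simp_all add: FD1_def FD2_def)
  have cons1: "(\<Sum>j1 = 1..nv1 G. FD1 G ?f j1 j2 $ k) = 0" if "j2 \<in> {1..nv2 G}" "k < ndof G" for j2 k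
    using assms(2,3) that unfolding fd_conservative_def vm_state_wf_def by blast
  have cons2: "(\<Sum>j2 = 1..nv2 G. FD2 G ?f j1 j2 $ k) = 0" if "j1 \<in> {1..nv1 G}" "k < ndof G" for j1 k
    using assms(2,3) that unfolding fd_conservative_def vm_state_wf_def by blast
  fix r assume "r < dim_vec (0\<^sub>v (ndof G) :: real vec)"
  then have r: "r < ndof G" by simp
  have N: "sf (vm_N G U) j1 j2 $ r = - (\<Sum>k<ndof G. ?X j2 $$ (r, k) * FD1 G ?f j1 j2 $ k)
      - (\<Sum>k<ndof G. ?Y j1 $$ (r, k) * FD2 G ?f j1 j2 $ k)" for j1 j2
  proof -
    have "sf (vm_N G U) j1 j2 $ r = - ((?X j2 *\<^sub>v FD1 G ?f j1 j2) $ r + (?Y j1 *\<^sub>v FD2 G ?f j1 j2) $ r)"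
      using r carrier_matD(1)[OF mult_mat_carrier[OF assms(1)]]
      by (simp add: vm_N_def del: index_mult_mat_vec)
    then show ?thesis
      using mult_mat_vec_index_sum[OF X fd(1) r] mult_mat_vec_index_sum[OF Y fd(2) r] by simp
  qed
  \<comment> \<open>Here the two velocity sums must be swapped first, since \<open>j1\<close> is the
    differenced index.\<close>
  have "(\<Sum>j1 = 1..nv1 G. \<Sum>j2 = 1..nv2 G. \<Sum>k<ndof G. ?X j2 $$ (r, k) * FD1 G ?f j1 j2 $ k)
      = (\<Sum>j2 = 1..nv2 G. \<Sum>k<ndof G. ?X j2 $$ (r, k) * (\<Sum>j1 = 1..nv1 G. FD1 G ?f j1 j2 $ k))"
    by (subst sum.swap) (simp only: sum_distrib_left sum.swap[of _ _ "{..<ndof G}"])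
  also have "\<dots> = 0" using cons1 by simp
  finally have zero1: "(\<Sum>j1 = 1..nv1 G. \<Sum>j2 = 1..nv2 G. \<Sum>k<ndof G. ?X j2 $$ (r, k) * FD1 G ?f j1 j2 $ k) = 0" .
  have "(\<Sum>j1 = 1..nv1 G. \<Sum>j2 = 1..nv2 G. \<Sum>k<ndof G. ?Y j1 $$ (r, k) * FD2 G ?f j1 j2 $ k)
      = (\<Sum>j1 = 1..nv1 G. \<Sum>k<ndof G. ?Y j1 $$ (r, k) * (\<Sum>j2 = 1..nv2 G. FD2 G ?f j1 j2 $ k))"
    by (simp only: sum_distrib_left sum.swap[of _ _ "{..<ndof G}"])
  also have "\<dots> = 0" using cons2 by simp
  finally have zero2: "(\<Sum>j1 = 1..nv1 G. \<Sum>j2 = 1..nv2 G. \<Sum>k<ndof G. ?Y j1 $$ (r, k) * FD2 G ?f j1 j2 $ k) = 0" .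
  show "vel_sum G (sf (vm_N G U)) $ r = 0\<^sub>v (ndof G) $ r"
    using r zero1 zero2 by (simp only: vel_sum_def index_vec N sum_subtractf sum_negf index_zero_vec)
qed simp

text \<open>By linearity the equation involves \<open>f\<close> only through its velocity sum, the
  density.\<close>

lemma discrete_poisson_iff:
  assumes P: "P \<in> carrier_mat (ndof G) (ndof G)" and "vm_state_wf G U"
  shows "discrete_poisson G P U \<longleftrightarrow> (dg_mat G + P) *\<^sub>v sE1 U =
    - ((dv1 G * dv2 G) \<cdot>\<^sub>v (vel_sum G (sf U) - P *\<^sub>v vel_sum G (sf U)))"
proof -
  have f: "sf U j1 j2 \<in> carrier_vec (ndof G)" if "j1 \<in> {1..nv1 G}" "j2 \<in> {1..nv2 G}" for j1 j2
    using assms(2) that by (auto simp: vm_state_wf_def)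
  have IP: "1\<^sub>m (ndof G) - P \<in> carrier_mat (ndof G) (ndof G)" using P by (rule minus_carrier_mat)
  have "vel_sum G (\<lambda>j1 j2. (dv1 G * dv2 G) \<cdot>\<^sub>v ((1\<^sub>m (ndof G) - P) *\<^sub>v sf U j1 j2))
      = (dv1 G * dv2 G) \<cdot>\<^sub>v vel_sum G (\<lambda>j1 j2. (1\<^sub>m (ndof G) - P) *\<^sub>v sf U j1 j2)"
    using f IP by (intro vel_sum_smult mult_mat_vec_carrier) auto
  also have "vel_sum G (\<lambda>j1 j2. (1\<^sub>m (ndof G) - P) *\<^sub>v sf U j1 j2) = (1\<^sub>m (ndof G) - P) *\<^sub>v vel_sum G (sf U)"
    using mult_mat_vel_sum[OF IP f] by simp
  also have "\<dots> = vel_sum G (sf U) - P *\<^sub>v vel_sum G (sf U)"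
    using minus_mult_distrib_mat_vec[OF one_carrier_mat P vel_sum_carrier] by simp
  finally show ?thesis by (simp add: discrete_poisson_def)
qed

text \<open>Expresses the field update through the densities before and after the
  exponential.\<close>

lemma vm_exp_sE1:
  assumes f: "\<And>j1 j2. j1 \<in> {1..nv1 G} \<Longrightarrow> j2 \<in> {1..nv2 G} \<Longrightarrow> sf U j1 j2 \<in> carrier_vec (ndof G)"
  shows "sE1 (vm_exp G P t U) = sE1 U + (dv1 G * dv2 G) \<cdot>\<^sub>v (minv (dg_mat G + P) *\<^sub>v
    (vel_sum G (sf U) - vel_sum G (sf (vm_exp G P t U))))"
proof -
  have "vel_sum G (\<lambda>j1 j2. (1\<^sub>m (ndof G) - expA G (v1 G j1 * t)) *\<^sub>v sf U j1 j2)
      = vel_sum G (\<lambda>j1 j2. sf U j1 j2 - expA G (v1 G j1 * t) *\<^sub>v sf U j1 j2)"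
    using minus_mult_distrib_mat_vec[OF one_carrier_mat expA_carrier f] f
    by (intro vel_sum_cong) simp
  also have "\<dots> = vel_sum G (sf U) - vel_sum G (\<lambda>j1 j2. expA G (v1 G j1 * t) *\<^sub>v sf U j1 j2)"
    using f by (intro vel_sum_diff mult_mat_vec_carrier[OF expA_carrier])
  finally show ?thesis by (simp add: vm_exp_def Let_def)
qed

text \<open>For each velocity \<open>P\<close> absorbs the exponential, whatever the time and the
  speed; summation preserves this.\<close>

lemma kernel_projection_vel_sum_vm_exp:
  assumes "dx G > 0" "kernel_projection G P"
    and f: "\<And>j1 j2. j1 \<in> {1..nv1 G} \<Longrightarrow> j2 \<in> {1..nv2 G} \<Longrightarrow> sf U j1 j2 \<in> carrier_vec (ndof G)"
  shows "P *\<^sub>v vel_sum G (sf (vm_exp G P t U)) = P *\<^sub>v vel_sum G (sf U)"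
proof -
  note P = kernel_projectionD(1)[OF assms(2)]
  have "P *\<^sub>v vel_sum G (sf (vm_exp G P t U))
      = vel_sum G (\<lambda>j1 j2. P *\<^sub>v (expA G (v1 G j1 * t) *\<^sub>v sf U j1 j2))"
    using f by (subst mult_mat_vel_sum[OF P])
      (auto simp: vm_exp_def Let_def intro: mult_mat_vec_carrier[OF expA_carrier])
  also have "\<dots> = vel_sum G (\<lambda>j1 j2. P *\<^sub>v sf U j1 j2)"
    using f kernel_projection_expA[OF assms(1,2)] by (intro vel_sum_cong) auto
  also have "\<dots> = P *\<^sub>v vel_sum G (sf U)" using mult_mat_vel_sum[OF P f] by simp
  finally show ?thesis .
qed

text \<open>Times \<open>\<tau>\<close>, weights \<open>w\<close> and states \<open>V\<close> are
  arbitrary, so that the Euler step and the final Runge-Kutta combination are both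
  instances.\<close>

lemma discrete_poisson_step:
  assumes dx: "dx G > 0" and fd: "fd_conservative G" and proj: "kernel_projection G P"
    and wf: "vm_state_wf G U" and poisson: "discrete_poisson G P U"
    and V: "\<And>q. q \<in> Q \<Longrightarrow> vm_state_wf G (V q)"
  shows "discrete_poisson G P
    (add_incr G (vm_exp G P t U) h Q w (\<lambda>q. vm_exp G P (\<tau> q) (vm_N G (V q))))"
    (is "discrete_poisson G P ?U'")
proof -
  let ?n = "ndof G" and ?T = "dg_mat G + P" and ?R = "minv (dg_mat G + P)" and ?c = "dv1 G * dv2 G"
  let ?s = "vel_sum G (sf U)" and ?se = "vel_sum G (sf (vm_exp G P t U))"
  let ?sq = "\<lambda>q. vel_sum G (sf (vm_exp G P (\<tau> q) (vm_N G (V q))))"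
  let ?s' = "vel_sum G (sf ?U')"
  note P = kernel_projectionD(1)[OF proj]
  have T: "?T \<in> carrier_mat ?n ?n" using P by simp
  note inv = minv_inverse[OF T dg_mat_plus_projection_inj[OF dx proj]]
  have f: "sf U j1 j2 \<in> carrier_vec ?n" if "j1 \<in> {1..nv1 G}" "j2 \<in> {1..nv2 G}" for j1 j2
    using wf that by (auto simp: vm_state_wf_def)
  have E: "sE1 U \<in> carrier_vec ?n" using wf by (simp add: vm_state_wf_def)
  have TR: "?T *\<^sub>v (?c \<cdot>\<^sub>v (?R *\<^sub>v x)) = ?c \<cdot>\<^sub>v x" if x: "x \<in> carrier_vec ?n" for x
  proof -
    have "?T *\<^sub>v (?c \<cdot>\<^sub>v (?R *\<^sub>v x)) = ?c \<cdot>\<^sub>v (?T *\<^sub>v (?R *\<^sub>v x))"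
      using x by (intro mult_mat_vec[OF T]) (rule mult_mat_vec_carrier[OF inv(2)])
    also have "?T *\<^sub>v (?R *\<^sub>v x) = x"
      using assoc_mult_mat_vec[OF T inv(2) x] inv(1) x by simp
    finally show ?thesis .
  qed
  have cR: "?c \<cdot>\<^sub>v (?R *\<^sub>v x) \<in> carrier_vec ?n" if "x \<in> carrier_vec ?n" for x
    using that by (intro smult_carrier_vec[THEN iffD2] mult_mat_vec_carrier[OF inv(2)])
  have sN: "vel_sum G (sf (vm_N G (V q))) = 0\<^sub>v ?n" if "q \<in> Q" for q
    using vel_sum_vm_N[OF dx fd V[OF that]] .
  have s': "?s' = vec_incr ?n ?se h Q w ?sq"
    unfolding add_incr_sel by (rule vel_sum_incr)
  have "P *\<^sub>v ?s' = vec_incr ?n (P *\<^sub>v ?se) h Q w (\<lambda>q. P *\<^sub>v ?sq q)"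
    unfolding s' by (rule mult_mat_vec_incr[OF P]) simp_all
  \<comment> \<open>The increments contribute nothing: their projected densities equal those of the
    nonlinear terms, which are zero.\<close>
  also have "\<dots> = P *\<^sub>v ?s"
  proof -
    have "P *\<^sub>v ?se = P *\<^sub>v ?s" using kernel_projection_vel_sum_vm_exp[OF dx proj f] .
    moreover have "P *\<^sub>v ?sq q = 0\<^sub>v ?n" if "q \<in> Q" for q
      using kernel_projection_vel_sum_vm_exp[OF dx proj vm_N_sf_carrier[OF dx]] sN[OF that] P
      by (auto simp: scalar_prod_def intro!: eq_vecI)
    ultimately show ?thesis using P by (intro eq_vecI) (auto simp: vec_incr_def)
  qed
  finally have Ps': "P *\<^sub>v ?s' = P *\<^sub>v ?s" .
  have E': "?T *\<^sub>v sE1 ?U' = vec_incr ?n (?T *\<^sub>v sE1 U + ?c \<cdot>\<^sub>v (?s - ?se)) h Q w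
      (\<lambda>q. ?c \<cdot>\<^sub>v (vel_sum G (sf (vm_N G (V q))) - ?sq q))"
  proof -
    have N0: "sE1 (vm_N G (V q)) = 0\<^sub>v ?n" for q by (simp add: vm_N_def)
    have "sE1 ?U' = vec_incr ?n (sE1 U + ?c \<cdot>\<^sub>v (?R *\<^sub>v (?s - ?se))) h Q w
        (\<lambda>q. ?c \<cdot>\<^sub>v (?R *\<^sub>v (vel_sum G (sf (vm_N G (V q))) - ?sq q)))"
      unfolding add_incr_sel using vm_exp_sE1[of G U P t, OF f]
        vm_exp_sE1[OF vm_N_sf_carrier[OF dx]] cR
      by (simp add: N0)
    moreover have "?T *\<^sub>v \<dots> = vec_incr ?n (?T *\<^sub>v (sE1 U + ?c \<cdot>\<^sub>v (?R *\<^sub>v (?s - ?se)))) h Q w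
        (\<lambda>q. ?T *\<^sub>v (?c \<cdot>\<^sub>v (?R *\<^sub>v (vel_sum G (sf (vm_N G (V q))) - ?sq q))))"
      using E by (intro mult_mat_vec_incr[OF T] add_carrier_vec cR minus_carrier_vec) auto
    moreover have "?T *\<^sub>v (sE1 U + ?c \<cdot>\<^sub>v (?R *\<^sub>v (?s - ?se))) = ?T *\<^sub>v sE1 U + ?c \<cdot>\<^sub>v (?s - ?se)"
      using mult_add_distrib_mat_vec[OF T E cR, of "?s - ?se"] TR[of "?s - ?se"] by simp
    moreover have "?T *\<^sub>v (?c \<cdot>\<^sub>v (?R *\<^sub>v (vel_sum G (sf (vm_N G (V q))) - ?sq q)))
        = ?c \<cdot>\<^sub>v (vel_sum G (sf (vm_N G (V q))) - ?sq q)" for q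
      by (rule TR) simp
    ultimately show ?thesis by simp
  qed
  have TE: "?T *\<^sub>v sE1 U = - (?c \<cdot>\<^sub>v (?s - P *\<^sub>v ?s))"
    using discrete_poisson_iff[OF P wf] poisson by simp
  have "?T *\<^sub>v sE1 ?U' = - (?c \<cdot>\<^sub>v (?s' - P *\<^sub>v ?s'))"
  proof (rule eq_vecI)
    fix r assume "r < dim_vec (- (?c \<cdot>\<^sub>v (?s' - P *\<^sub>v ?s')))"
    then have r: "r < ?n" using P by simp
    define a where "a = (P *\<^sub>v ?s) $ r"
    have s'r: "?s' $ r = ?se $ r + h * (\<Sum>q\<in>Q. w q * ?sq q $ r)"
      using r by (simp add: s' vec_incr_def)
    have "(\<Sum>q\<in>Q. w q * (?c \<cdot>\<^sub>v (vel_sum G (sf (vm_N G (V q))) - ?sq q)) $ r)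
        = (\<Sum>q\<in>Q. - ?c * (w q * ?sq q $ r))"
      using r by (intro sum.cong refl) (simp add: sN)
    also have "\<dots> = - ?c * (\<Sum>q\<in>Q. w q * ?sq q $ r)" by (simp only: sum_distrib_left)
    finally have sumN: "(\<Sum>q\<in>Q. w q * (?c \<cdot>\<^sub>v (vel_sum G (sf (vm_N G (V q))) - ?sq q)) $ r)
        = - ?c * (\<Sum>q\<in>Q. w q * ?sq q $ r)" .
    \<comment> \<open>The old density \<open>?s\<close> cancels between the Poisson equation for
      \<open>U\<close> and the exponential update. What remains is the new density minus its
      projection, which is \<open>a\<close> both before and after the step.\<close>
    have "(?T *\<^sub>v sE1 ?U') $ r = - (?c * (?s $ r - a)) + ?c * (?s $ r - ?se $ r)
        + h * (- ?c * (\<Sum>q\<in>Q. w q * ?sq q $ r))"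
      using r P unfolding E' TE vec_incr_def a_def index_vec[OF r] sumN
      by (simp del: index_mult_mat_vec)
    also have "\<dots> = - (?c * (?s' $ r - a))" unfolding s'r by (simp add: algebra_simps)
    also have "\<dots> = (- (?c \<cdot>\<^sub>v (?s' - P *\<^sub>v ?s'))) $ r"
      unfolding Ps' using r P by (simp add: a_def del: index_mult_mat_vec)
    finally show "(?T *\<^sub>v sE1 ?U') $ r = (- (?c \<cdot>\<^sub>v (?s' - P *\<^sub>v ?s'))) $ r" .
  qed (use P in simp)
  then show ?thesis using discrete_poisson_iff[OF P vm_state_wf_add_incr] by simp
qed

theorem proposition5:
  fixes G :: vm_disc and P :: "real mat" and h :: real and U :: "nat \<Rightarrow> vm_state"
  assumes "ncell G \<ge> 1" and "xlen G > 0"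
    and "vmax1 G > 0" and "vmax2 G > 0" and "nv1 G \<ge> 1" and "nv2 G \<ge> 1"
    and "fd_conservative G"
    and "kernel_projection G P"
    and "h > 0"
    and "vm_state_wf G (U 0)"
    and scheme: "(\<forall>n. U (Suc n) = lawson_euler G P h (U n)) \<or>
      (\<exists>s a b c. \<forall>n. lawson_rk_step G P h s a b c (U n) (U (Suc n)))"
    and "discrete_poisson G P (U 0)"
  shows "\<forall>n \<ge> 1. discrete_poisson G P (U n)"
proof -
  have dx: "dx G > 0" using assms(1,2) by (simp add: dx_def)
  note step = discrete_poisson_step[OF dx \<open>fd_conservative G\<close> \<open>kernel_projection G P\<close>]
  \<comment> \<open>Well-formedness is carried along because conservativity is available only for
    distributions of the right dimension.\<close>
  have "vm_state_wf G (U n) \<and> discrete_poisson G P (U n)" for n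
  proof (induction n)
    case (Suc n)
    from scheme show ?case
    proof
      assume "\<forall>n. U (Suc n) = lawson_euler G P h (U n)"
      then have U': "U (Suc n) = add_incr G (vm_exp G P h (U n)) h {0} (\<lambda>_. 1)
          (\<lambda>_. vm_exp G P h (vm_N G (U n)))"
        by (simp add: lawson_euler_def)
      show ?thesis unfolding U' using Suc by (intro conjI vm_state_wf_add_incr step) auto
    next
      assume "\<exists>s a b c. \<forall>n. lawson_rk_step G P h s a b c (U n) (U (Suc n))"
      then obtain s a b c where "lawson_rk_step G P h s a b c (U n) (U (Suc n))" by blast
      then obtain S where S: "\<forall>p \<in> {1..s}. S p =
             add_incr G (vm_exp G P (c p * h) (U n)) h {1..<p} (a p)
               (\<lambda>q. vm_exp G P ((c p - c q) * h) (vm_N G (S q)))"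
          and U': "U (Suc n) = add_incr G (vm_exp G P h (U n)) h {1..s} b
                 (\<lambda>p. vm_exp G P ((1 - c p) * h) (vm_N G (S p)))"
        unfolding lawson_rk_step_def by blast
      \<comment> \<open>The stages only have to be well-formed, so that their nonlinear terms carry
        no charge; the Poisson equation is used at \<open>U n\<close> alone.\<close>
      have "vm_state_wf G (S p)" if "p \<in> {1..s}" for p
        using S[rule_format, OF that] vm_state_wf_add_incr by metis
      then show ?thesis unfolding U' using Suc by (intro conjI vm_state_wf_add_incr step) auto
    qed
  qed (use assms in simp)
  then show ?thesis by blast
qed

end
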